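(* Let $a>b>0$, $c^2=a^2-b^2$, and let $\mathcal{E}$ be the ellipse $x^2/a^2+y^2/b^2=1$. Let $a_\triangle=\frac{ac^2}{a^2+3b^2}$, $b_\triangle=\frac{bc^2}{3a^2+b^2}$, and let $C=[a_\triangle\cos t,\,b_\triangle\sin t]$ with $t\in\mathbb{R}$. Let $\mathcal{T}_\triangle$ be the Poncelet family of triangles inscribed in $\mathcal{E}$ and circumscribing a circle centered at $C$, and let $\mathcal{L}_5$ be the locus (a line segment) of the Euler center $X_5$ over $\mathcal{T}_\triangle$. Then, over $\mathcal{T}_\triangle$, Feuerbach's point $X_{11}$ (resp. the center $X_{80}$) is stationary at the non-$C$ intersection of $\mathcal{L}_5$ (a segment) with the incircle (resp. with $\mathcal{E}$). These points are given by \[ X_{11}=\frac{a^2+b^2}{c^2}\left[a_\triangle\cos t,\,-b_\triangle\sin t\right],\qquad X_{80}=\left[a\cos t,\,-b\sin t\right]. \]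
   Context: For each point $C=[x_c,y_c]$ interior to $\mathcal{E}$ there is a circle $\mathcal{K}$ centered at $C$, nested in $\mathcal{E}$, admitting triangles inscribed in $\mathcal{E}$ with all sides tangent to $\mathcal{K}$; its radius is $r=\big(b\sqrt{a^4-c^2x_c^2}-a\sqrt{b^4+c^2y_c^2}\big)/c^2$. By Poncelet's porism every point of $\mathcal{E}$ is then a vertex of such a triangle; the Poncelet family about the circle centered at $C$ is the one-parameter family of all these triangles, and $\mathcal{K}$ is their common incircle, with incenter $X_1=C$. The ellipse $\mathcal{E}_\triangle=\{[a_\triangle\cos t,b_\triangle\sin t]\}$ is the locus of centroids of all equilateral triangles inscribed in $\mathcal{E}$; when $C\in\mathcal{E}_\triangle$ the family contains an equilateral triangle, and the locus $\mathcal{L}_5$ of the Euler center $X_5$ (center of the nine-point circle) is a line segment with an endpoint at $C$. Feuerbach's point $X_{11}$ is the point where the incircle and the nine-point circle touch (not defined for an equilateral triangle). $X_{80}$ is the reflection of $X_1$ about $X_{11}$. A center is stationary if it takes the same position for all triangles of the family for which it is defined.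
   Formalization: The segment L5 itself never contains X11 or X80 (a=2, b=1, t=0: L5=[15/28,6/7]×{0}, X11=(10/7,0), X80=(2,0)); the intersections with the incircle and with E are taken instead with the prolongation of L5 beyond its endpoint C. *)

theory Defs
  imports "HOL-Analysis.Analysis"
begin

type_synonym point = "real \<times> real"
type_synonym triangle = "point \<times> point \<times> point"

definition ellipse :: "real \<Rightarrow> real \<Rightarrow> point set" where
  "ellipse a b = {(x, y). x\<^sup>2 / a\<^sup>2 + y\<^sup>2 / b\<^sup>2 = 1}"

definition ellipse_interior :: "real \<Rightarrow> real \<Rightarrow> point set" where
  "ellipse_interior a b = {(x, y). x\<^sup>2 / a\<^sup>2 + y\<^sup>2 / b\<^sup>2 < 1}"

(* The set l is meant to be a line. *)
definition tangent_to_circle :: "point set \<Rightarrow> point \<Rightarrow> real \<Rightarrow> bool" where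
  "tangent_to_circle l C r \<longleftrightarrow> (\<exists>T. l \<inter> sphere C r = {T})"

fun nondegenerate :: "triangle \<Rightarrow> bool" where
  "nondegenerate (P, Q, R) \<longleftrightarrow> \<not> collinear {P, Q, R}"

fun inscribed_in :: "triangle \<Rightarrow> point set \<Rightarrow> bool" where
  "inscribed_in (P, Q, R) S \<longleftrightarrow> P \<in> S \<and> Q \<in> S \<and> R \<in> S"

fun sides_tangent_to :: "triangle \<Rightarrow> point \<Rightarrow> real \<Rightarrow> bool" where
  "sides_tangent_to (P, Q, R) C r \<longleftrightarrow>
     tangent_to_circle (affine hull {P, Q}) C r \<and>
     tangent_to_circle (affine hull {Q, R}) C r \<and>
     tangent_to_circle (affine hull {R, P}) C r"

fun equilateral :: "triangle \<Rightarrow> bool" where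
  "equilateral (P, Q, R) \<longleftrightarrow> dist P Q = dist Q R \<and> dist Q R = dist R P"

(* Triangles are ordered triples of vertices, so every geometric triangle of the
   family occurs once for each labelling of its vertices. *)
definition poncelet_family :: "real \<Rightarrow> real \<Rightarrow> point \<Rightarrow> triangle set" where
  "poncelet_family a b C =
     {T. nondegenerate T \<and> inscribed_in T (ellipse a b) \<and>
         (\<exists>r>0. sphere C r \<subseteq> ellipse_interior a b \<and> sides_tangent_to T C r)}"

(* A circle tangent to all three side lines is the incircle or one of the three
   excircles; the condition on I leaves only the incircle.
   Its center I is the center X(1). *)
fun is_incircle :: "triangle \<Rightarrow> point \<Rightarrow> real \<Rightarrow> bool" where
  "is_incircle (P, Q, R) I r \<longleftrightarrow>
     r > 0 \<and> I \<in> convex hull {P, Q, R} \<and> sides_tangent_to (P, Q, R) I r"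

fun is_nine_point_circle :: "triangle \<Rightarrow> point \<Rightarrow> real \<Rightarrow> bool" where
  "is_nine_point_circle (P, Q, R) N s \<longleftrightarrow>
     {midpoint P Q, midpoint Q R, midpoint R P} \<subseteq> sphere N s"

(* X(5) *)
definition is_euler_center :: "triangle \<Rightarrow> point \<Rightarrow> bool" where
  "is_euler_center T N \<longleftrightarrow> (\<exists>s. is_nine_point_circle T N s)"

(* X(11).  For an equilateral triangle the two circles coincide, so that no point F
   satisfies this. *)
definition is_feuerbach_point :: "triangle \<Rightarrow> point \<Rightarrow> bool" where
  "is_feuerbach_point T F \<longleftrightarrow>
     (\<exists>I r N s. is_incircle T I r \<and> is_nine_point_circle T N s \<and> sphere I r \<inter> sphere N s = {F})"

(* X(80): the point Z such that X(11) is the midpoint of X(1) and Z. *)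
definition is_X80 :: "triangle \<Rightarrow> point \<Rightarrow> bool" where
  "is_X80 T Z \<longleftrightarrow>
     (\<exists>I r F. is_incircle T I r \<and> is_feuerbach_point T F \<and> Z = 2 *\<^sub>R F - I)"

definition euler_locus :: "triangle set \<Rightarrow> point set" where
  "euler_locus \<T> = {N. \<exists>T\<in>\<T>. is_euler_center T N}"

(* For a nondegenerate segment S with endpoint C: the part of the line carrying S that
   lies on the other side of C from S, with C included. *)
definition extension_beyond :: "point set \<Rightarrow> point \<Rightarrow> point set" where
  "extension_beyond S C = {p \<in> affine hull S. \<forall>q\<in>S. C \<in> closed_segment p q}"

end

theory Submission
  imports Defs "HOL-Computational_Algebra.Fundamental_Theorem_Algebra"
begin

text \<open>Scale the ellipse to the unit circle by \<open>u = x/a + i y/b\<close>. The circle centered at \<open>C\<close> becomes an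
  ellipse with foci \<open>f\<close>, \<open>g\<close> in the unit disc, and the vertices of the triangles of the Poncelet family
  are the solutions of \<open>z (z - f) (z - g) = l (1 - cnj f z) (1 - cnj g z)\<close>, where \<open>l\<close> runs through the unit
  circle. So the elementary symmetric functions of the vertices, and with them the centroid, the
  circumcenter and the Euler center \<open>N\<close>, are affine in \<open>l\<close> and \<open>cnj l\<close>. When \<open>C\<close> lies on the ellipse of
  centroids with parameter \<open>t\<close>, one finds \<open>N = C - \<delta> v\<close> with a fixed vector \<open>v\<close> and
  \<open>\<delta> = (1 - m) c\<^sup>2 / 4\<close>, where \<open>m = Re (cis (- t) l)\<close>, while the inradius is
  \<open>\<alpha> norm v\<close> and the radius of the nine-point circle is \<open>(\<alpha> + \<delta>) norm v\<close> with \<open>\<alpha> = 2 a\<^sup>2 b\<^sup>2 / c\<^sup>2\<close>.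
  Hence the two circles touch at \<open>C + \<alpha> v\<close> unless \<open>\<delta> = 0\<close>, which is the equilateral case.\<close>

section \<open>Plane geometry of triangles and circles\<close>

text \<open>The definition of the family leaves the radius of the circle open, so it must be shown
  that a single radius occurs: the closure condition for triangles is quadratic in r^2, and
  containment of the circle in the ellipse excludes a second solution. Tangency to the side lines
  also fits excircles; the center is placed inside the triangle by positive weights obtained from
  the derivative of the Blaschke product. The formulas of the overview rest on one identity. If C is
  to be the centroid of an equilateral triangle of the family, the scaled center must be a third of
  the vertex sum, while it is half of f + g. Hence cnj f cnj g l has to equal the scaled center for
  a unit number l; it turns out that l = cis t. The vertex sum then is the scaled center times 2 +
  cis (- t) l for all triangles. The vector v and the constant \<alpha> are read off from the
  claimed point: with C = (x, y), X11 - C is (2 b^2 x / c^2, - 2 a^2 y / c^2), which is \<alpha>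
  times (x / a^2, - y / b^2).\<close>

definition cross2 :: "point \<Rightarrow> point \<Rightarrow> point \<Rightarrow> real" where
  "cross2 P Q X = (fst Q - fst P) * (snd X - snd P) - (snd Q - snd P) * (fst X - fst P)"

lemma point_norm_sq: "(norm (p :: point))\<^sup>2 = (fst p)\<^sup>2 + (snd p)\<^sup>2"
  by (simp add: norm_prod_def)

lemma point_dist_sq: "(dist (p :: point) q)\<^sup>2 = (fst p - fst q)\<^sup>2 + (snd p - snd q)\<^sup>2"
  by (simp add: dist_norm point_norm_sq)

lemma collinear_iff_cross2: "collinear {P, Q, R} \<longleftrightarrow> cross2 P Q R = 0"
proof
  assume "collinear {P, Q, R}"
  then obtain z :: point where z: "\<And>x y. x \<in> {P, Q, R} \<Longrightarrow> y \<in> {P, Q, R} \<Longrightarrow> \<exists>k. x - y = k *\<^sub>R z"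
    unfolding collinear_def by blast
  obtain k l where "Q - P = k *\<^sub>R z" "R - P = l *\<^sub>R z"
    using z[of Q P] z[of R P] by auto
  hence "fst Q - fst P = k * fst z" "snd Q - snd P = k * snd z"
        "fst R - fst P = l * fst z" "snd R - snd P = l * snd z"
    by (metis fst_diff fst_scaleR snd_diff snd_scaleR real_scaleR_def)+
  thus "cross2 P Q R = 0"
    by (simp add: cross2_def)
next
  assume *: "cross2 P Q R = 0"
  show "collinear {P, Q, R}"
  proof (cases "P = Q")
    case True
    thus ?thesis by simp
  next
    case False
    \<comment> \<open>With \<open>d\<close> the squared length of Q - P and \<open>e\<close> its
      inner product with R - P, a vanishing cross product makes R - P equal to its projection (e /
      d) (Q - P).\<close>
    define d where "d = (dist P Q)\<^sup>2"
    define e where "e = (fst Q - fst P) * (fst R - fst P) + (snd Q - snd P) * (snd R - snd P)"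
    have d: "d = (fst Q - fst P)\<^sup>2 + (snd Q - snd P)\<^sup>2" "d \<noteq> 0"
      using False by (auto simp: d_def point_dist_sq power2_commute intro: prod_eqI)
    have "d * (fst R - fst P) = e * (fst Q - fst P)" "d * (snd R - snd P) = e * (snd Q - snd P)"
      using * unfolding d(1) e_def cross2_def by algebra+
    hence "d *\<^sub>R (R - P) = e *\<^sub>R (Q - P)"
      by (intro prod_eqI) simp_all
    hence "R - P = (e / d) *\<^sub>R (Q - P)"
      using d(2) by (metis (no_types, lifting) divide_inverse_commute scaleR_scaleR left_inverse scaleR_one)
    hence "R = P + (e / d) *\<^sub>R (Q - P)"
      by (simp add: algebra_simps)
    hence "R = (1 - e / d) *\<^sub>R P + (e / d) *\<^sub>R Q"
      by (simp add: algebra_simps)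
    hence "R \<in> affine hull {P, Q}"
      unfolding affine_hull_2 by (smt (verit) mem_Collect_eq)
    hence "collinear {R, P, Q}"
      by (metis affine_hull_3_imp_collinear insert_commute)
    thus ?thesis by (simp add: insert_commute)
  qed
qed

lemma quadratic_unique_root_iff:
  fixes A B E :: real
  assumes "A > 0"
  shows "(\<exists>!s. A * s\<^sup>2 + 2 * B * s + E = 0) \<longleftrightarrow> B\<^sup>2 = A * E"
proof -
  have eq: "A * s\<^sup>2 + 2 * B * s + E = 0 \<longleftrightarrow> (A * s + B)\<^sup>2 = B\<^sup>2 - A * E" for s
  proof -
    have "(A * s + B)\<^sup>2 - (B\<^sup>2 - A * E) = A * (A * s\<^sup>2 + 2 * B * s + E)"
      by (simp add: power2_eq_square algebra_simps)
    thus ?thesis using assms by auto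
  qed
  show ?thesis
  proof
    assume "\<exists>!s. A * s\<^sup>2 + 2 * B * s + E = 0"
    then obtain s where s: "(A * s + B)\<^sup>2 = B\<^sup>2 - A * E"
      and un: "\<And>s'. (A * s' + B)\<^sup>2 = B\<^sup>2 - A * E \<Longrightarrow> s' = s"
      unfolding eq by blast
    \<comment> \<open>The other root is the mirror image of s at - B / A; uniqueness makes it
      coincide with s.\<close>
    have "A * (- 2 * B / A - s) + B = - (A * s + B)"
      using assms by (simp add: field_simps)
    hence "- 2 * B / A - s = s"
      using un[of "- 2 * B / A - s"] s by (metis power2_minus)
    hence "A * s + B = 0" using assms by (simp add: field_simps)
    thus "B\<^sup>2 = A * E" using s by simp
  next
    assume "B\<^sup>2 = A * E"
    hence "A * s\<^sup>2 + 2 * B * s + E = 0 \<longleftrightarrow> s = - B / A" for s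
      unfolding eq using assms by (auto simp: field_simps add_eq_0_iff)
    thus "\<exists>!s. A * s\<^sup>2 + 2 * B * s + E = 0" by simp
  qed
qed

text \<open>Along the line, points of the circle are roots of a quadratic, so having a single common
  point means a vanishing discriminant. Lagrange's identity turns the discriminant into a comparison
  of r with the distance of C from the line.\<close>

lemma tangent_line_iff:
  assumes "P \<noteq> Q" and "r > 0"
  shows "tangent_to_circle (affine hull {P, Q}) C r \<longleftrightarrow> (cross2 P Q C)\<^sup>2 = r\<^sup>2 * (dist P Q)\<^sup>2"
proof -
  define L where "L s = P + s *\<^sub>R (Q - P)" for s
  define A where "A = (dist P Q)\<^sup>2"
  define B where "B = (fst Q - fst P) * (fst P - fst C) + (snd Q - snd P) * (snd P - snd C)"
  define E where "E = (dist P C)\<^sup>2 - r\<^sup>2"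
  have A: "A > 0" using assms(1) by (simp add: A_def)
  have hull: "affine hull {P, Q} = range L"
  proof -
    have L: "L s = (1 - s) *\<^sub>R P + s *\<^sub>R Q" for s
      by (simp add: L_def algebra_simps)
    show ?thesis
    proof (intro equalityI subsetI)
      fix X assume "X \<in> affine hull {P, Q}"
      then obtain u v where "u + v = 1" "X = u *\<^sub>R P + v *\<^sub>R Q"
        unfolding affine_hull_2 by blast
      moreover from this have "u = 1 - v" by simp
      ultimately have "X = L v" using L by simp
      thus "X \<in> range L" by blast
    next
      fix X assume "X \<in> range L"
      then obtain s where "X = (1 - s) *\<^sub>R P + s *\<^sub>R Q" using L by blast
      moreover have "(1 - s) + s = 1" by simp
      ultimately show "X \<in> affine hull {P, Q}" unfolding affine_hull_2 by blast
    qed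
  qed
  have inj: "L s = L s' \<longleftrightarrow> s = s'" for s s'
    using assms(1) by (auto simp: L_def)
  have "L s \<in> sphere C r \<longleftrightarrow> A * s\<^sup>2 + 2 * B * s + E = 0" for s
  proof -
    have "L s \<in> sphere C r \<longleftrightarrow> (dist (L s) C)\<^sup>2 = r\<^sup>2"
      using assms(2) by (auto simp: dist_commute)
    also have "(dist (L s) C)\<^sup>2 - r\<^sup>2 = A * s\<^sup>2 + 2 * B * s + E"
      unfolding point_dist_sq A_def B_def E_def L_def
      by (simp add: power2_eq_square algebra_simps)
    hence "(dist (L s) C)\<^sup>2 = r\<^sup>2 \<longleftrightarrow> A * s\<^sup>2 + 2 * B * s + E = 0"
      by linarith
    finally show ?thesis .
  qed
  hence "affine hull {P, Q} \<inter> sphere C r = L ` {s. A * s\<^sup>2 + 2 * B * s + E = 0}"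
    unfolding hull by auto
  hence "tangent_to_circle (affine hull {P, Q}) C r \<longleftrightarrow> (\<exists>T. L ` {s. A * s\<^sup>2 + 2 * B * s + E = 0} = {T})"
    unfolding tangent_to_circle_def by simp
  also have "\<dots> \<longleftrightarrow> (\<exists>s. {s. A * s\<^sup>2 + 2 * B * s + E = 0} = {s})"
  proof -
    have "(\<exists>T. L ` S = {T}) \<longleftrightarrow> (\<exists>s. S = {s})" for S
    proof
      assume "\<exists>T. L ` S = {T}"
      then obtain T where T: "L ` S = {T}" by blast
      then obtain s where "s \<in> S" by blast
      moreover have "s' = s" if "s' \<in> S" for s'
        using T that \<open>s \<in> S\<close> inj by (metis imageI singletonD)
      ultimately show "\<exists>s. S = {s}" by blast
    qed auto
    thus ?thesis by blast
  qed
  also have "\<dots> \<longleftrightarrow> (\<exists>!s. A * s\<^sup>2 + 2 * B * s + E = 0)"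
    by (simp add: set_eq_iff Ex1_def) blast
  also have "\<dots> \<longleftrightarrow> B\<^sup>2 = A * E"
    by (rule quadratic_unique_root_iff[OF A])
  also have "\<dots> \<longleftrightarrow> (cross2 P Q C)\<^sup>2 = r\<^sup>2 * (dist P Q)\<^sup>2"
  proof -
    have "A * E - B\<^sup>2 = (cross2 P Q C)\<^sup>2 - r\<^sup>2 * (dist P Q)\<^sup>2"
      unfolding A_def B_def E_def point_dist_sq cross2_def
      by (simp add: power2_eq_square algebra_simps)
    thus ?thesis by linarith
  qed
  finally show ?thesis .
qed

section \<open>Tangent sides, incircle and nine-point circle of a triangle\<close>

lemma nondegenerate_iff: "nondegenerate (P, Q, R) \<longleftrightarrow> cross2 P Q R \<noteq> 0"
  by (simp add: collinear_iff_cross2)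

lemma nondegenerate_distinct:
  assumes "nondegenerate (P, Q, R)"
  shows "P \<noteq> Q" "Q \<noteq> R" "R \<noteq> P"
  using assms unfolding nondegenerate_iff by (auto simp: cross2_def)

lemma sides_tangent_iff:
  assumes "nondegenerate (P, Q, R)" and "r > 0"
  shows "sides_tangent_to (P, Q, R) C r \<longleftrightarrow>
    (cross2 P Q C)\<^sup>2 = r\<^sup>2 * (dist P Q)\<^sup>2 \<and>
    (cross2 Q R C)\<^sup>2 = r\<^sup>2 * (dist Q R)\<^sup>2 \<and>
    (cross2 R P C)\<^sup>2 = r\<^sup>2 * (dist R P)\<^sup>2"
  using nondegenerate_distinct[OF assms(1)] assms(2) by (simp add: tangent_line_iff)

text \<open>Barycentric coordinates are ratios of signed areas, and tangency fixes their absolute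
  values. Membership of I in the convex hull makes them nonnegative, which singles out the incircle
  among the four tangent circles.\<close>

lemma incircle_barycentric:
  assumes "nondegenerate (P, Q, R)" and "is_incircle (P, Q, R) I r"
  shows "\<bar>cross2 P Q R\<bar> = r * (dist Q R + dist R P + dist P Q)"
    and "\<bar>cross2 P Q R\<bar> *\<^sub>R I = r *\<^sub>R (dist Q R *\<^sub>R P + dist R P *\<^sub>R Q + dist P Q *\<^sub>R R)"
proof -
  define D where "D = cross2 P Q R"
  have r: "r > 0" and "I \<in> convex hull {P, Q, R}" and tan: "sides_tangent_to (P, Q, R) I r"
    using assms(2) by auto
  then obtain \<alpha> \<beta> \<gamma> where nn: "0 \<le> \<alpha>" "0 \<le> \<beta>" "0 \<le> \<gamma>" and sum: "\<alpha> + \<beta> + \<gamma> = 1"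
    and I: "I = \<alpha> *\<^sub>R P + \<beta> *\<^sub>R Q + \<gamma> *\<^sub>R R"
    unfolding convex_hull_3 by blast
  have \<gamma>: "\<gamma> = 1 - \<alpha> - \<beta>" using sum by simp
  have cr: "cross2 P Q I = \<gamma> * D" "cross2 Q R I = \<alpha> * D" "cross2 R P I = \<beta> * D"
    unfolding I \<gamma> D_def cross2_def by (simp_all add: algebra_simps)
  have key: "x * \<bar>D\<bar> = r * d" if "(x * D)\<^sup>2 = r\<^sup>2 * d\<^sup>2" "0 \<le> x" "0 \<le> d" for x d
  proof -
    have "(x * \<bar>D\<bar>)\<^sup>2 = (r * d)\<^sup>2"
      using that(1) by (simp add: power_mult_distrib)
    moreover have "0 \<le> x * \<bar>D\<bar>" "0 \<le> r * d" using that(2,3) r by simp_all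
    ultimately show ?thesis by (rule power2_eq_imp_eq)
  qed
  have bary: "\<gamma> * \<bar>D\<bar> = r * dist P Q" "\<alpha> * \<bar>D\<bar> = r * dist Q R" "\<beta> * \<bar>D\<bar> = r * dist R P"
    using tan[unfolded sides_tangent_iff[OF assms(1) r] cr]
    by (blast intro: key nn zero_le_dist)+
  have "\<bar>D\<bar> = (\<alpha> + \<beta> + \<gamma>) * \<bar>D\<bar>" using sum by simp
  also have "\<dots> = r * (dist Q R + dist R P + dist P Q)"
    using bary by (simp add: algebra_simps)
  finally show "\<bar>cross2 P Q R\<bar> = r * (dist Q R + dist R P + dist P Q)"
    by (simp add: D_def)
  have "\<bar>D\<bar> *\<^sub>R I = (\<alpha> * \<bar>D\<bar>) *\<^sub>R P + (\<beta> * \<bar>D\<bar>) *\<^sub>R Q + (\<gamma> * \<bar>D\<bar>) *\<^sub>R R"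
    unfolding I by (simp add: algebra_simps)
  thus "\<bar>cross2 P Q R\<bar> *\<^sub>R I = r *\<^sub>R (dist Q R *\<^sub>R P + dist R P *\<^sub>R Q + dist P Q *\<^sub>R R)"
    unfolding bary by (simp add: D_def algebra_simps)
qed

lemma incircle_unique:
  assumes "nondegenerate (P, Q, R)" and "is_incircle (P, Q, R) I r" and "is_incircle (P, Q, R) J s"
  shows "I = J \<and> r = s"
proof -
  have D: "\<bar>cross2 P Q R\<bar> \<noteq> 0" using assms(1) unfolding nondegenerate_iff by simp
  note 1 = incircle_barycentric[OF assms(1,2)] and 2 = incircle_barycentric[OF assms(1,3)]
  have "r = s"
    using 1(1) 2(1) D by (metis mult_cancel_right mult_zero_right)
  thus ?thesis using 1(2) 2(2) D by (metis scaleR_left_imp_eq)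
qed

lemma equilateral_incenter:
  assumes "nondegenerate (P, Q, R)" and "is_incircle (P, Q, R) I r" and "equilateral (P, Q, R)"
  shows "3 *\<^sub>R I = P + Q + R"
proof -
  have eq: "dist Q R = dist P Q" "dist R P = dist P Q" using assms(3) by auto
  have D: "r * dist P Q \<noteq> 0"
    using assms nondegenerate_distinct(1)[OF assms(1)] by auto
  note 1 = incircle_barycentric[OF assms(1,2), unfolded eq]
  have "(r * dist P Q) *\<^sub>R (3 *\<^sub>R I) = (r * dist P Q) *\<^sub>R (P + Q + R)"
    using 1(2) unfolding 1(1) by (simp add: algebra_simps)
  thus ?thesis using D scaleR_left_imp_eq by blast
qed

text \<open>The vectors from X to the vertices have length \<rho> and sum zero, so by the
  parallelogram law each squared side is 2 \<rho>^2 + 2 \<rho>^2 - \<rho>^2.\<close>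

lemma centroid_circumcenter_equilateral:
  assumes "3 *\<^sub>R X = P + Q + R" and "dist P X = \<rho>" "dist Q X = \<rho>" "dist R X = \<rho>"
  shows "equilateral (P, Q, R)"
proof -
  have x: "3 * fst X = fst P + fst Q + fst R" "3 * snd X = snd P + snd Q + snd R"
    using assms(1) by (metis fst_add fst_scaleR real_scaleR_def, metis snd_add snd_scaleR real_scaleR_def)
  note d = assms(2-4)[THEN arg_cong[where f = "\<lambda>x. x\<^sup>2"], unfolded point_dist_sq]
  have R: "fst R = 3 * fst X - fst P - fst Q" "snd R = 3 * snd X - snd P - snd Q"
    using x by auto
  have "(dist P Q)\<^sup>2 = 3 * \<rho>\<^sup>2" "(dist Q R)\<^sup>2 = 3 * \<rho>\<^sup>2" "(dist R P)\<^sup>2 = 3 * \<rho>\<^sup>2"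
    using d unfolding point_dist_sq R by (simp_all add: power2_eq_square algebra_simps)
  thus ?thesis
    by simp (metis power2_eq_iff_nonneg zero_le_dist)
qed

text \<open>The homothety x -> P + Q + R - 2 x, of ratio - 2 about the centroid, takes the midpoint
  of each side to the opposite vertex. So circles through the midpoints correspond to circles
  through the vertices.\<close>

lemma nine_point_circle_iff:
  assumes "nondegenerate (P, Q, R)" 
    and "dist P X = \<rho>" "dist Q X = \<rho>" "dist R X = \<rho>"
  shows "is_nine_point_circle (P, Q, R) N s \<longleftrightarrow> 2 *\<^sub>R N = P + Q + R - X \<and> 2 * s = \<rho>"
proof -
  have conv: "midpoint P Q \<in> sphere N s \<longleftrightarrow> dist R (P + Q + R - 2 *\<^sub>R N) = 2 * s" for P Q R :: point
  proof -
    have "R - (P + Q + R - 2 *\<^sub>R N) = 2 *\<^sub>R (N - midpoint P Q)"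
      by (simp add: midpoint_def algebra_simps)
    hence "dist R (P + Q + R - 2 *\<^sub>R N) = 2 * dist N (midpoint P Q)"
      by (simp add: dist_norm)
    thus ?thesis by simp
  qed
  define Y where "Y = P + Q + R - 2 *\<^sub>R N"
  have Y: "Q + R + P - 2 *\<^sub>R N = Y" "R + P + Q - 2 *\<^sub>R N = Y" by (simp_all add: Y_def)
  have "is_nine_point_circle (P, Q, R) N s \<longleftrightarrow> dist R Y = 2 * s \<and> dist P Y = 2 * s \<and> dist Q Y = 2 * s"
    using conv[of P Q R] conv[of Q R P] conv[of R P Q] unfolding Y Y_def[symmetric] by simp
  also have "\<dots> \<longleftrightarrow> Y = X \<and> 2 * s = \<rho>"
  proof
    assume *: "dist R Y = 2 * s \<and> dist P Y = 2 * s \<and> dist Q Y = 2 * s"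
    note d = assms(2-4)[THEN arg_cong[where f = "\<lambda>x. x\<^sup>2"], unfolded point_dist_sq]
    have e: "(dist R Y)\<^sup>2 = (2 * s)\<^sup>2" "(dist P Y)\<^sup>2 = (2 * s)\<^sup>2" "(dist Q Y)\<^sup>2 = (2 * s)\<^sup>2"
      using * by simp_all
    note e = e[unfolded point_dist_sq]
    \<comment> \<open>Two circles through the vertices: comparing their equations at different
      vertices gives a linear system for X - Y with determinant \<open>cross2 P Q R\<close>.\<close>
    have "cross2 P Q R * (fst X - fst Y) = 0" "cross2 P Q R * (snd X - snd Y) = 0"
      using d e unfolding cross2_def by algebra+
    hence "X = Y"
      using assms(1) unfolding nondegenerate_iff by (auto intro: prod_eqI)
    thus "Y = X \<and> 2 * s = \<rho>" using * assms by simp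
  qed (use assms in simp)
  also have "\<dots> \<longleftrightarrow> 2 *\<^sub>R N = P + Q + R - X \<and> 2 * s = \<rho>"
    by (auto simp: Y_def)
  finally show ?thesis .
qed

text \<open>The distance of the centers is the difference of the radii. For a common point C + Y the
  two equations leave the equality case of the Cauchy-Schwarz inequality for Y and v.\<close>

lemma internally_tangent_spheres:
  fixes C v :: "'a :: real_inner"
  assumes "\<alpha> > 0" and "\<delta> > 0"
  shows "sphere C (\<alpha> * norm v) \<inter> sphere (C - \<delta> *\<^sub>R v) ((\<alpha> + \<delta>) * norm v) = {C + \<alpha> *\<^sub>R v}"
proof (intro equalityI subsetI)
  fix X assume X: "X \<in> sphere C (\<alpha> * norm v) \<inter> sphere (C - \<delta> *\<^sub>R v) ((\<alpha> + \<delta>) * norm v)"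
  define Y where "Y = X - C"
  have "norm Y = \<alpha> * norm v" "norm (Y + \<delta> *\<^sub>R v) = (\<alpha> + \<delta>) * norm v"
    using X by (simp_all add: Y_def dist_norm norm_minus_commute algebra_simps)
  hence Y: "Y \<bullet> Y = \<alpha>\<^sup>2 * (v \<bullet> v)" "(Y + \<delta> *\<^sub>R v) \<bullet> (Y + \<delta> *\<^sub>R v) = (\<alpha> + \<delta>)\<^sup>2 * (v \<bullet> v)"
    by (metis power2_norm_eq_inner power_mult_distrib)+
  have "2 * \<delta> * (Y \<bullet> v) = 2 * \<delta> * (\<alpha> * (v \<bullet> v))"
    using Y by (simp add: inner_add inner_commute power2_eq_square algebra_simps)
  hence "Y \<bullet> v = \<alpha> * (v \<bullet> v)" using assms by simp
  hence "(Y - \<alpha> *\<^sub>R v) \<bullet> (Y - \<alpha> *\<^sub>R v) = 0"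
    using Y(1) by (simp add: inner_diff inner_commute power2_eq_square algebra_simps)
  hence "Y = \<alpha> *\<^sub>R v" by simp
  thus "X \<in> {C + \<alpha> *\<^sub>R v}" by (simp add: Y_def algebra_simps)
next
  fix X assume "X \<in> {C + \<alpha> *\<^sub>R v}"
  hence X: "X = C + \<alpha> *\<^sub>R v" by simp
  have "C - \<delta> *\<^sub>R v - X = - ((\<alpha> + \<delta>) *\<^sub>R v)" by (simp add: X algebra_simps)
  hence "norm (C - \<delta> *\<^sub>R v - X) = (\<alpha> + \<delta>) * norm v"
    using assms by (metis abs_of_pos add_pos_pos norm_minus_cancel norm_scaleR)
  moreover have "norm (C - X) = \<alpha> * norm v" using assms by (simp add: X)
  ultimately show "X \<in> sphere C (\<alpha> * norm v) \<inter> sphere (C - \<delta> *\<^sub>R v) ((\<alpha> + \<delta>) * norm v)"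
    by (simp add: dist_norm)
qed

text \<open>Replaces the extension by a ray with parameter \<tau>, on which meeting the incircle or
  the ellipse is an equation in \<tau>.\<close>

lemma extension_beyond_segment:
  fixes C v :: point
  assumes "\<delta> > 0" and "v \<noteq> 0"
  shows "extension_beyond (closed_segment C (C - \<delta> *\<^sub>R v)) C = {C + \<tau> *\<^sub>R v | \<tau>. 0 \<le> \<tau>}"
proof (intro equalityI subsetI)
  fix p assume "p \<in> extension_beyond (closed_segment C (C - \<delta> *\<^sub>R v)) C"
  hence "p \<in> affine hull closed_segment C (C - \<delta> *\<^sub>R v)"
    and seg: "C \<in> closed_segment p (C - \<delta> *\<^sub>R v)"
    unfolding extension_beyond_def by auto
  hence "p \<in> affine hull {C, C - \<delta> *\<^sub>R v}" by (simp add: segment_convex_hull)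
  then obtain x y where "x + y = 1" "p = x *\<^sub>R C + y *\<^sub>R (C - \<delta> *\<^sub>R v)"
    unfolding affine_hull_2 by blast
  hence p: "p = C + (- y * \<delta>) *\<^sub>R v"
    by (metis (no_types, lifting) add_diff_eq mult_minus_left scaleR_diff_right scaleR_left.add
        scaleR_minus_left scaleR_one scaleR_scaleR uminus_add_conv_diff add.commute diff_conv_add_uminus)
  obtain u where u: "0 \<le> u" "u \<le> 1" "C = (1 - u) *\<^sub>R p + u *\<^sub>R (C - \<delta> *\<^sub>R v)"
    using seg unfolding closed_segment_def by blast
  have "((1 - u) * (- y * \<delta>) - u * \<delta>) *\<^sub>R v = 0"
    using u(3) unfolding p by (simp add: algebra_simps)
  hence "(1 - u) * (- y) * \<delta> = u * \<delta>" using assms(2) unfolding scaleR_eq_0_iff by (simp add: mult.assoc)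
  hence uy: "(1 - u) * (- y) = u" using assms(1) by (metis less_irrefl mult_right_cancel)
  have "- y \<ge> 0"
  proof (rule ccontr)
    assume "\<not> - y \<ge> 0"
    hence "(1 - u) * (- y) \<le> 0" using u(2) by (intro mult_nonneg_nonpos) auto
    hence "u = 0" using uy u(1) by linarith
    thus False using uy \<open>\<not> - y \<ge> 0\<close> by simp
  qed
  thus "p \<in> {C + \<tau> *\<^sub>R v | \<tau>. 0 \<le> \<tau>}"
    using p assms(1) by (auto intro!: exI[of _ "- y * \<delta>"] simp: mult_nonpos_nonneg)
next
  fix p assume "p \<in> {C + \<tau> *\<^sub>R v | \<tau>. 0 \<le> \<tau>}"
  then obtain \<tau> where p: "p = C + \<tau> *\<^sub>R v" and \<tau>: "0 \<le> \<tau>" by blast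
  have "p = (1 + \<tau> / \<delta>) *\<^sub>R C + (- \<tau> / \<delta>) *\<^sub>R (C - \<delta> *\<^sub>R v)"
    using assms(1) by (simp add: p algebra_simps)
  hence "p \<in> affine hull {C, C - \<delta> *\<^sub>R v}"
    unfolding affine_hull_2 by (intro CollectI exI[of _ "1 + \<tau> / \<delta>"] exI[of _ "- \<tau> / \<delta>"]) simp
  hence 1: "p \<in> affine hull closed_segment C (C - \<delta> *\<^sub>R v)"
    by (simp add: segment_convex_hull)
  have 2: "C \<in> closed_segment p q" if "q \<in> closed_segment C (C - \<delta> *\<^sub>R v)" for q
  proof -
    obtain u where u: "0 \<le> u" "u \<le> 1" "q = (1 - u) *\<^sub>R C + u *\<^sub>R (C - \<delta> *\<^sub>R v)"
      using \<open>q \<in> _\<close> unfolding closed_segment_def by blast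
    define \<sigma> where "\<sigma> = u * \<delta>"
    have q: "q = C - \<sigma> *\<^sub>R v" using u(3) by (simp add: \<sigma>_def algebra_simps)
    have \<sigma>: "0 \<le> \<sigma>" using u assms(1) by (simp add: \<sigma>_def)
    show ?thesis
    proof (cases "\<tau> + \<sigma> = 0")
      case True
      hence "\<sigma> = 0" using \<tau> \<sigma> by linarith
      thus ?thesis by (simp add: q)
    next
      case False
      hence pos: "\<tau> + \<sigma> > 0" using \<tau> \<sigma> by linarith
      define x where "x = \<tau> / (\<tau> + \<sigma>)"
      have x: "0 \<le> x" "x \<le> 1" "(1 - x) * \<tau> = x * \<sigma>"
        using pos \<tau> \<sigma> by (simp_all add: x_def field_simps)
      have "(1 - x) *\<^sub>R p + x *\<^sub>R q = C + ((1 - x) * \<tau> - x * \<sigma>) *\<^sub>R v"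
        by (simp add: p q algebra_simps)
      hence "C = (1 - x) *\<^sub>R p + x *\<^sub>R q" using x by simp
      thus ?thesis using x unfolding closed_segment_def by blast
    qed
  qed
  show "p \<in> extension_beyond (closed_segment C (C - \<delta> *\<^sub>R v)) C"
    unfolding extension_beyond_def using 1 2 by simp
qed

text \<open>For two distinct parameters Vieta's formula gives
  \<open>\<tau> * \<sigma> * \<gamma> = M - 1\<close>, which is negative for an interior point C, so
  they cannot both be nonnegative.\<close>

lemma ray_meets_ellipse_once:
  fixes C v :: point
  assumes "a > 0" "b > 0" "C \<in> ellipse_interior a b"
    and "0 \<le> \<tau>" "C + \<tau> *\<^sub>R v \<in> ellipse a b" and "0 \<le> \<sigma>" "C + \<sigma> *\<^sub>R v \<in> ellipse a b"
  shows "\<tau> = \<sigma>"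
proof (rule ccontr)
  assume ne: "\<tau> \<noteq> \<sigma>"
  define \<beta> where "\<beta> = fst C * fst v / a\<^sup>2 + snd C * snd v / b\<^sup>2"
  define \<gamma> where "\<gamma> = (fst v)\<^sup>2 / a\<^sup>2 + (snd v)\<^sup>2 / b\<^sup>2"
  define M where "M = (fst C)\<^sup>2 / a\<^sup>2 + (snd C)\<^sup>2 / b\<^sup>2"
  have M: "M < 1" using assms(3) by (auto simp: ellipse_interior_def M_def)
  have \<gamma>: "\<gamma> \<ge> 0" by (simp add: \<gamma>_def)
  have q: "M + 2 * x * \<beta> + x\<^sup>2 * \<gamma> = 1" if "C + x *\<^sub>R v \<in> ellipse a b" for x
  proof -
    have "(fst C + x * fst v)\<^sup>2 / a\<^sup>2 + (snd C + x * snd v)\<^sup>2 / b\<^sup>2 = 1"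
      using that by (simp add: ellipse_def case_prod_unfold)
    thus ?thesis unfolding M_def \<beta>_def \<gamma>_def by (simp add: power2_sum power_mult_distrib add_divide_distrib algebra_simps)
  qed
  have "(\<tau> - \<sigma>) * (2 * \<beta> + (\<tau> + \<sigma>) * \<gamma>) = 0" using q[OF assms(5)] q[OF assms(7)] by algebra
  hence "2 * \<beta> + (\<tau> + \<sigma>) * \<gamma> = 0" using ne by simp
  hence "M - \<tau> * \<sigma> * \<gamma> = 1" using q[OF assms(5)] by algebra
  moreover have "\<tau> * \<sigma> * \<gamma> \<ge> 0" using assms \<gamma> by simp
  ultimately show False using M by linarith
qed

section \<open>Triples parametrized by Blaschke products\<close>

lemma unit_cnj: "cmod u = 1 \<Longrightarrow> u * cnj u = 1"
  by (metis complex_norm_square of_real_1 one_power2)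

text \<open>Vieta's relations for the cubic z (z - f) (z - g) - l (1 - cnj f z) (1 - cnj g z) with l
  = u v w. This form keeps track of multiplicities and gives the vertex sum directly.\<close>

definition blaschke_triple :: "complex \<Rightarrow> complex \<Rightarrow> complex \<Rightarrow> complex \<Rightarrow> complex \<Rightarrow> bool" where
  "blaschke_triple f g u v w \<longleftrightarrow> cmod u = 1 \<and> cmod v = 1 \<and> cmod w = 1 \<and>
     u + v + w = f + g + cnj f * cnj g * (u * v * w) \<and>
     u * v + v * w + w * u = f * g + (cnj f + cnj g) * (u * v * w)"

lemma blaschke_triple_rotate: "blaschke_triple f g u v w \<Longrightarrow> blaschke_triple f g v w u"
  unfolding blaschke_triple_def by (simp add: ac_simps)

lemma blaschke_triple_root:
  assumes "blaschke_triple f g u v w"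
  shows "u * (u - f) * (u - g) = u * v * w * (1 - cnj f * u) * (1 - cnj g * u)"
proof -
  have "u + v + w = f + g + cnj f * cnj g * (u * v * w)"
    "u * v + v * w + w * u = f * g + (cnj f + cnj g) * (u * v * w)"
    using assms by (simp_all add: blaschke_triple_def)
  thus ?thesis by algebra
qed

section \<open>Location, existence and simplicity of the roots of the Blaschke cubic\<close>

lemma disc_factor_norm:
  "(cmod (1 - cnj f * z))\<^sup>2 - (cmod (z - f))\<^sup>2 = (1 - (cmod f)\<^sup>2) * (1 - (cmod z)\<^sup>2)"
  unfolding cmod_power2 by (simp add: power2_eq_square algebra_simps)

text \<open>By \<open>disc_factor_norm\<close>, z - h is smaller in modulus than 1 - cnj h z inside
  the unit disc and larger outside. With the extra factor z the two sides can have equal modulus on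
  the circle only.\<close>

lemma blaschke_root_unit:
  assumes f: "cmod f < 1" and g: "cmod g < 1" and l: "cmod l = 1"
    and eq: "z * (z - f) * (z - g) = l * (1 - cnj f * z) * (1 - cnj g * z)"
  shows "cmod z = 1"
proof (rule ccontr)
  assume ne: "cmod z \<noteq> 1"
  have sq: "0 < 1 - (cmod h)\<^sup>2" if "cmod h < 1" for h
    using that by (simp add: power_less_one_iff)
  have E: "cmod z * (cmod (z - f) * cmod (z - g)) = cmod (1 - cnj f * z) * cmod (1 - cnj g * z)"
    using arg_cong[OF eq, of cmod] l by (simp add: norm_mult mult.assoc)
  consider "cmod z < 1" | "cmod z > 1" using ne by linarith
  thus False
  proof cases
    case 1
    have lt: "cmod (z - h) < cmod (1 - cnj h * z)" if "cmod h < 1" for h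
    proof (rule power_less_imp_less_base)
      have "0 < (1 - (cmod h)\<^sup>2) * (1 - (cmod z)\<^sup>2)"
        using sq[OF that] sq[OF 1] by (rule mult_pos_pos)
      thus "(cmod (z - h))\<^sup>2 < (cmod (1 - cnj h * z))\<^sup>2"
        using disc_factor_norm[of h z] by linarith
    qed simp
    have "cmod z * (cmod (z - f) * cmod (z - g)) \<le> 1 * (cmod (z - f) * cmod (z - g))"
      using 1 by (intro mult_right_mono) auto
    also have "\<dots> < cmod (1 - cnj f * z) * cmod (1 - cnj g * z)"
      unfolding mult_1_left using lt[OF f] lt[OF g] by (intro mult_strict_mono') simp_all
    finally show False using E by simp
  next
    case 2
    have sz: "1 - (cmod z)\<^sup>2 < 0" using 2 by (simp add: one_less_power)
    have lt: "cmod (1 - cnj h * z) < cmod (z - h)" if "cmod h < 1" for h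
    proof (rule power_less_imp_less_base)
      have "(1 - (cmod h)\<^sup>2) * (1 - (cmod z)\<^sup>2) < 0"
        using sq[OF that] sz by (rule mult_pos_neg)
      thus "(cmod (1 - cnj h * z))\<^sup>2 < (cmod (z - h))\<^sup>2"
        using disc_factor_norm[of h z] by linarith
    qed simp
    have "cmod (1 - cnj f * z) * cmod (1 - cnj g * z) < cmod (z - f) * cmod (z - g)"
      using lt[OF f] lt[OF g] by (intro mult_strict_mono') simp_all
    also have "\<dots> = 1 * (cmod (z - f) * cmod (z - g))" by simp
    also have "\<dots> \<le> cmod z * (cmod (z - f) * cmod (z - g))"
      using 2 by (intro mult_right_mono) auto
    finally show False using E by simp
  qed
qed

text \<open>One root comes from the fundamental theorem of algebra, the other two from the quadratic
  formula, and all of them have modulus 1. This is the existence part of Poncelet's porism, with l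
  as the parameter of the family.\<close>

lemma blaschke_triple_exists:
  assumes f: "cmod f < 1" and g: "cmod g < 1" and l: "cmod l = 1"
  obtains u v w where "blaschke_triple f g u v w" "u * v * w = l"
proof -
  define e1 e2 where "e1 = f + g + cnj f * cnj g * l" and "e2 = f * g + (cnj f + cnj g) * l"
  have "\<exists>u. poly [:- l, e2, - e1, 1:] u = 0"
    by (intro fundamental_theorem_of_algebra) (simp add: constant_degree)
  then obtain u where u: "u^3 - e1 * u^2 + e2 * u - l = 0"
    by (auto simp: algebra_simps power2_eq_square power3_eq_cube)
  define d where "d = csqrt ((e1 - u)\<^sup>2 - 4 * (e2 - u * (e1 - u)))"
  define v w where "v = (e1 - u + d) / 2" and "w = (e1 - u - d) / 2"
  have d: "d\<^sup>2 = (e1 - u)\<^sup>2 - 4 * (e2 - u * (e1 - u))" by (simp add: d_def)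
  have sum: "v + w = e1 - u" by (simp add: v_def w_def field_simps)
  have "4 * (v * w) = (e1 - u)\<^sup>2 - d\<^sup>2"
    unfolding v_def w_def by (simp add: power2_eq_square field_simps)
  hence "4 * (v * w) = 4 * (e2 - u * (e1 - u))" unfolding d by simp
  hence prod: "v * w = e2 - u * (e1 - u)" by (metis mult_cancel_left zero_neq_numeral)
  have e1: "u + v + w = e1" using sum by (simp add: algebra_simps)
  have e2: "u * v + v * w + w * u = e2" using sum prod by algebra
  have e3: "u * v * w = l" using u prod by algebra
  have root: "cmod z = 1" if "(z - u) * (z - v) * (z - w) = 0" for z
  proof (rule blaschke_root_unit[OF f g l])
    have "(z - u) * (z - v) * (z - w) = z^3 - e1 * z^2 + e2 * z - l"
      unfolding e1[symmetric] e2[symmetric] e3[symmetric] by algebra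
    thus "z * (z - f) * (z - g) = l * (1 - cnj f * z) * (1 - cnj g * z)"
      using that unfolding e1_def e2_def by algebra
  qed
  have "blaschke_triple f g u v w"
    unfolding blaschke_triple_def e1 e2 e3
    using root[of u] root[of v] root[of w] by (simp add: e1_def e2_def)
  thus ?thesis using e3 that by blast
qed

text \<open>The left-hand side is the derivative at u of the cubic with roots u, v, w. Computed from
  the Blaschke form of the cubic, the same derivative is (u - f) (u - g) times u B'(u) / B(u), where
  B is the Blaschke product.\<close>

lemma blaschke_triple_derivative:
  assumes T: "blaschke_triple f g u v w" and f: "cmod f < 1" and g: "cmod g < 1"
  obtains K :: real where "K > 1" "(u - v) * (u - w) = (u - f) * (u - g) * of_real K" "u \<noteq> f" "u \<noteq> g"
proof -
  \<comment> \<open>The value of u B'(u) / B(u) on the unit circle: 1 for the factor z, and the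
    Poisson kernels of f and g for the other two factors.\<close>
  define K where "K = 1 + (1 - (cmod f)\<^sup>2) / (cmod (u - f))\<^sup>2 + (1 - (cmod g)\<^sup>2) / (cmod (u - g))\<^sup>2"
  define F G U where "F = cnj f" and "G = cnj g" and "U = cnj u"
  have u: "cmod u = 1" using T by (simp add: blaschke_triple_def)
  hence U: "u * U = 1" using unit_cnj by (simp add: U_def)
  have ne: "u \<noteq> f" "u \<noteq> g" using u f g by auto
  hence ne': "U \<noteq> F" "U \<noteq> G" by (simp_all add: U_def F_def G_def)
  have nf: "of_real ((cmod (u - f))\<^sup>2) = (u - f) * (U - F)" "of_real ((cmod (u - g))\<^sup>2) = (u - g) * (U - G)"
    "of_real ((cmod f)\<^sup>2) = f * F" "of_real ((cmod g)\<^sup>2) = g * G"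
    by (simp_all only: complex_norm_square U_def F_def G_def complex_cnj_diff)
  have K1: "K > 1"
    using ne f g by (simp add: K_def add_pos_pos power_less_one_iff)
  have K: "of_real K * ((u - f) * (U - F) * ((u - g) * (U - G))) =
     (u - f) * (U - F) * ((u - g) * (U - G)) + (1 - f * F) * ((u - g) * (U - G)) + (1 - g * G) * ((u - f) * (U - F))"
  proof -
    have "(1 + y / x + y' / x') * (x * x') = x * x' + y * x' + y' * x" if "x \<noteq> 0" "x' \<noteq> 0" for x x' y y' :: complex
      using that by (simp add: field_simps)
    thus ?thesis
      using ne ne' unfolding K_def of_real_add of_real_divide of_real_diff nf of_real_1 by simp
  qed
  have root: "u * v * w * ((U - F) * (U - G)) = U * (u - f) * (u - g)"
  proof -
    have "u * (u - f) * (u - g) = u * v * w * (1 - F * u) * (1 - G * u)"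
      using blaschke_triple_root[OF T] by (simp add: F_def G_def)
    moreover have "U - F = U * (1 - F * u)" "U - G = U * (1 - G * u)"
      using U by algebra+
    ultimately show ?thesis using U by algebra
  qed
  have der: "(u - v) * (u - w) = 3 * u\<^sup>2 - 2 * u * (f + g) - 2 * u * (F * G * (u * v * w)) + f * g + (F + G) * (u * v * w)"
  proof -
    have "u + v + w = f + g + F * G * (u * v * w)"
      "u * v + v * w + w * u = f * g + (F + G) * (u * v * w)"
      using T by (simp_all add: blaschke_triple_def F_def G_def)
    thus ?thesis by algebra
  qed
  have "(u - v) * (u - w) * ((U - F) * (U - G)) =
     (3 * u\<^sup>2 - 2 * u * (f + g) + f * g) * ((U - F) * (U - G)) + (F + G - 2 * u * F * G) * (U * (u - f) * (u - g))"
    unfolding root[symmetric] der by (simp add: algebra_simps)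
  also have "\<dots> = (u - f) * (U - F) * ((u - g) * (U - G)) + (1 - f * F) * ((u - g) * (U - G)) + (1 - g * G) * ((u - f) * (U - F))"
    using U by algebra
  also have "\<dots> = (u - f) * (u - g) * of_real K * ((U - F) * (U - G))"
    unfolding K[symmetric] by (simp add: algebra_simps)
  finally have "(u - v) * (u - w) = (u - f) * (u - g) * of_real K"
    using ne' by simp
  thus ?thesis using K1 ne that by blast
qed

lemma blaschke_triple_distinct:
  assumes "blaschke_triple f g u v w" and "cmod f < 1" and "cmod g < 1"
  shows "u \<noteq> v" "v \<noteq> w" "w \<noteq> u"
proof -
  have *: "u \<noteq> v" "u \<noteq> w" if "blaschke_triple f g u v w" for u v w
    using blaschke_triple_derivative[OF that assms(2,3)] by (metis mult_eq_0_iff of_real_eq_0_iff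
        right_minus_eq not_one_less_zero)+
  show "u \<noteq> v" "w \<noteq> u" using *[OF assms(1)] by auto
  show "v \<noteq> w" using *[OF blaschke_triple_rotate[OF assms(1)]] by auto
qed

text \<open>Shows that the center of the tangent circle lies inside the triangle. The numbers x, y,
  z are the residues of the rational function with zeros f, g and poles u, v, w; its expansion at
  infinity gives their sum 1 and the weighted vertex sum u + v + w - f - g. Each is of the form 1 /
  K, hence below 1, so the complementary weights are positive.\<close>

lemma blaschke_triple_foci_midpoint:
  assumes T: "blaschke_triple f g u v w" and f: "cmod f < 1" and g: "cmod g < 1"
  obtains \<alpha> \<beta> \<gamma> :: real where "\<alpha> > 0" "\<beta> > 0" "\<gamma> > 0" "\<alpha> + \<beta> + \<gamma> = 1"
    "(f + g) / 2 = of_real \<alpha> * u + of_real \<beta> * v + of_real \<gamma> * w"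
proof -
  have ne: "u \<noteq> v" "v \<noteq> w" "w \<noteq> u" using blaschke_triple_distinct[OF assms] .
  have ex: "\<exists>m::real. 0 < m \<and> m < 1 \<and> (u - f) * (u - g) = of_real m * ((u - v) * (u - w))"
    if T: "blaschke_triple f g u v w" for u v w
  proof -
    obtain K :: real where "K > 1" "(u - v) * (u - w) = (u - f) * (u - g) * of_real K"
      using blaschke_triple_derivative[OF T f g] .
    thus ?thesis by (intro exI[of _ "1 / K"]) (simp add: field_simps)
  qed
  obtain x where x: "0 < x" "x < 1" "(u - f) * (u - g) = of_real x * ((u - v) * (u - w))"
    using ex[OF T] by blast
  obtain y where y: "0 < y" "y < 1" "(v - f) * (v - g) = of_real y * ((v - w) * (v - u))"
    using ex[OF blaschke_triple_rotate[OF T]] by blast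
  obtain z where z: "0 < z" "z < 1" "(w - f) * (w - g) = of_real z * ((w - u) * (w - v))"
    using ex[OF blaschke_triple_rotate[OF blaschke_triple_rotate[OF T]]] by blast
  have V: "(u - v) * (v - w) * (w - u) \<noteq> 0" using ne by simp
  have "((u - v) * (v - w) * (w - u)) * (of_real x + of_real y + of_real z - 1) = 0"
    using x(3) y(3) z(3) by algebra
  hence "complex_of_real (x + y + z) = 1" using V by simp
  hence xyz: "x + y + z = 1" by (metis of_real_eq_1_iff)
  have "((u - v) * (v - w) * (w - u)) * (of_real x * u + of_real y * v + of_real z * w - (u + v + w - f - g)) = 0"
    using x(3) y(3) z(3) by algebra
  hence "of_real x * u + of_real y * v + of_real z * w = u + v + w - f - g" using V by simp
  hence "f + g = of_real (1 - x) * u + of_real (1 - y) * v + of_real (1 - z) * w"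
    by (simp add: algebra_simps)
  hence "(f + g) / 2 = of_real ((1 - x) / 2) * u + of_real ((1 - y) / 2) * v + of_real ((1 - z) / 2) * w"
    by (simp add: add_divide_distrib)
  thus ?thesis using x y z xyz by (intro that[of "(1 - x) / 2" "(1 - y) / 2" "(1 - z) / 2"]) (auto simp: field_simps)
qed

section \<open>Poncelet triangles about a circle in an ellipse\<close>

definition ept :: "real \<Rightarrow> real \<Rightarrow> complex \<Rightarrow> point" where
  "ept a b z = (a * Re z, b * Im z)"

lemma ept_linear:
  "ept a b (x + y) = ept a b x + ept a b y"
  "ept a b (x - y) = ept a b x - ept a b y"
  "ept a b (of_real s * x) = s *\<^sub>R ept a b x"
  by (simp_all add: ept_def algebra_simps)

text \<open>Points \<open>z\<close> of the chord through unit numbers \<open>u\<close>, \<open>v\<close> satisfy \<open>z + u v cnj z = u + v\<close>, so the left-hand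
  side below is the squared deviation of \<open>w\<close> from the chord; the right-hand side is the squared radius
  times the squared length of the normal in the coordinates before the ellipse is scaled to the circle.\<close>
definition chord_tangent :: "real \<Rightarrow> real \<Rightarrow> complex \<Rightarrow> complex \<Rightarrow> complex \<Rightarrow> bool" where
  "chord_tangent k n w u v \<longleftrightarrow>
     (w + u * v * cnj w - (u + v))\<^sup>2 = 2 * of_real n * (u * v) - of_real k * ((u * v)\<^sup>2 + 1)"

lemma complex_parts:
  "of_real (Re z) = (z + cnj z) / 2" "of_real (Im z) = (z - cnj z) / (2 * \<i>)"
  by (simp_all add: complex_eq_iff)

text \<open>On the unit circle conjugates are inverses, so both sides are rational in u and v. After
  multiplication by (u v)^2 both carry the factor (v - u)^2, which cancels for distinct
  endpoints.\<close>

lemma chord_tangent_iff: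
  assumes "a > 0" "b > 0" and u: "cmod u = 1" and v: "cmod v = 1" and ne: "u \<noteq> v"
  shows "(cross2 (ept a b u) (ept a b v) (ept a b w))\<^sup>2 = r\<^sup>2 * (dist (ept a b u) (ept a b v))\<^sup>2 \<longleftrightarrow>
    chord_tangent (r\<^sup>2 * (a\<^sup>2 - b\<^sup>2) / (a\<^sup>2 * b\<^sup>2)) (r\<^sup>2 * (a\<^sup>2 + b\<^sup>2) / (a\<^sup>2 * b\<^sup>2)) w u v"
proof -
  define U V W where "U = cnj u" and "V = cnj v" and "W = cnj w"
  define A B R where "A = complex_of_real a" and "B = complex_of_real b" and "R = complex_of_real r"
  have U: "u * U = 1" and V: "v * V = 1" using u v by (simp_all add: unit_cnj U_def V_def)
  have nz: "u \<noteq> 0" "v \<noteq> 0" using u v by auto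
  have AB: "A \<noteq> 0" "B \<noteq> 0" using assms by (simp_all add: A_def B_def)
  define cr where "cr = complex_of_real (cross2 (ept a b u) (ept a b v) (ept a b w))"
  define dd where "dd = complex_of_real ((dist (ept a b u) (ept a b v))\<^sup>2)"
  have "2 * \<i> * cr = A * B * ((V - U) * (w - u) - (v - u) * (W - U))"
    unfolding cr_def cross2_def ept_def fst_conv snd_conv of_real_mult of_real_diff complex_parts
      U_def[symmetric] V_def[symmetric] W_def[symmetric] A_def[symmetric] B_def[symmetric]
    by (simp add: field_simps)
  from this[symmetric] have cr: "- 4 * cr\<^sup>2 = (A * B * ((V - U) * (w - u) - (v - u) * (W - U)))\<^sup>2"
    by (simp add: power_mult_distrib)
  have dd: "4 * dd = A\<^sup>2 * (u - v + (U - V))\<^sup>2 - B\<^sup>2 * (u - v - (U - V))\<^sup>2"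
    unfolding dd_def point_dist_sq ept_def fst_conv snd_conv of_real_mult of_real_diff of_real_add of_real_power
      complex_parts
      U_def[symmetric] V_def[symmetric] W_def[symmetric] A_def[symmetric] B_def[symmetric]
    by (simp add: field_simps power2_eq_square)
  define E where "E = (A * B * (w + u * v * W - (u + v)))\<^sup>2 - R\<^sup>2 * (2 * (A\<^sup>2 + B\<^sup>2) * (u * v) - (A\<^sup>2 - B\<^sup>2) * ((u * v)\<^sup>2 + 1))"
  have S: "(u * v)\<^sup>2 * ((V - U) * (w - u) - (v - u) * (W - U))\<^sup>2 = (v - u)\<^sup>2 * (w + u * v * W - (u + v))\<^sup>2"
    using U V by algebra
  have S2: "(u * v)\<^sup>2 * (A\<^sup>2 * (u - v + (U - V))\<^sup>2 - B\<^sup>2 * (u - v - (U - V))\<^sup>2) =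
     (v - u)\<^sup>2 * ((A\<^sup>2 - B\<^sup>2) * ((u * v)\<^sup>2 + 1) - 2 * (A\<^sup>2 + B\<^sup>2) * (u * v))"
    using U V by algebra
  have "- 4 * (u * v)\<^sup>2 * (cr\<^sup>2 - R\<^sup>2 * dd) = (u * v)\<^sup>2 * (- 4 * cr\<^sup>2) + R\<^sup>2 * ((u * v)\<^sup>2 * (4 * dd))"
    by (simp add: algebra_simps)
  also have "\<dots> = (v - u)\<^sup>2 * E"
    unfolding cr dd S2 E_def power_mult_distrib[of "A * B"] using S by algebra
  finally have "cr\<^sup>2 = R\<^sup>2 * dd \<longleftrightarrow> E = 0" using nz ne by auto
  moreover have "cr\<^sup>2 = R\<^sup>2 * dd \<longleftrightarrow>
      (cross2 (ept a b u) (ept a b v) (ept a b w))\<^sup>2 = r\<^sup>2 * (dist (ept a b u) (ept a b v))\<^sup>2"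
    unfolding cr_def dd_def R_def of_real_mult[symmetric] of_real_power[symmetric] of_real_eq_iff ..
  moreover have "E = 0 \<longleftrightarrow> chord_tangent (r\<^sup>2 * (a\<^sup>2 - b\<^sup>2) / (a\<^sup>2 * b\<^sup>2)) (r\<^sup>2 * (a\<^sup>2 + b\<^sup>2) / (a\<^sup>2 * b\<^sup>2)) w u v"
  proof -
    define X where "X = (w + u * v * W - (u + v))\<^sup>2"
    have "E = A\<^sup>2 * B\<^sup>2 * X - R\<^sup>2 * (2 * (A\<^sup>2 + B\<^sup>2) * (u * v) - (A\<^sup>2 - B\<^sup>2) * ((u * v)\<^sup>2 + 1))"
      unfolding E_def X_def by (simp add: power_mult_distrib)
    moreover have "X = 2 * (R\<^sup>2 * (A\<^sup>2 + B\<^sup>2) / (A\<^sup>2 * B\<^sup>2)) * (u * v) - R\<^sup>2 * (A\<^sup>2 - B\<^sup>2) / (A\<^sup>2 * B\<^sup>2) * ((u * v)\<^sup>2 + 1)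
       \<longleftrightarrow> A\<^sup>2 * B\<^sup>2 * X = R\<^sup>2 * (2 * (A\<^sup>2 + B\<^sup>2) * (u * v) - (A\<^sup>2 - B\<^sup>2) * ((u * v)\<^sup>2 + 1))"
    proof -
      have "X = 2 * (R\<^sup>2 * x / d) * s - R\<^sup>2 * y / d * s' \<longleftrightarrow> d * X = R\<^sup>2 * (2 * x * s - y * s')"
        if "d \<noteq> 0" for x y s s' d
        using that by (simp add: field_simps)
      thus ?thesis using AB by simp
    qed
    ultimately show ?thesis
      unfolding chord_tangent_def X_def W_def A_def B_def R_def by simp
  qed
  ultimately show ?thesis by simp
qed

text \<open>For a fixed vertex the tangency condition is quadratic in the other endpoint of the
  chord, so Vieta's formulas give sum and product of the two remaining vertices. The product yields
  the Blaschke cubic, the sum the closure condition.\<close>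

lemma chord_tangent_triple:
  assumes u: "cmod u = 1" and v: "cmod v = 1" and z: "cmod z = 1"
    and ne: "u \<noteq> v" "v \<noteq> z" "z \<noteq> u"
    and t: "chord_tangent k n w u v" "chord_tangent k n w v z" "chord_tangent k n w z u"
    and fg: "f + g = 2 * w" "f * g = w\<^sup>2 + of_real k"
  shows "blaschke_triple f g u v z" and "(cmod (f * g))\<^sup>2 = 2 * (cmod w)\<^sup>2 + 2 * n - 1"
proof -
  define W where "W = cnj w"
  define p q P Q l where "p = f + g" and "q = f * g" and "P = cnj f + cnj g" and "Q = cnj f * cnj g"
    and "l = u * v * z"
  have PQ: "P = 2 * W" "Q = W\<^sup>2 + of_real k" "p = 2 * w" "q = w\<^sup>2 + of_real k"
  proof -
    have "P = cnj (f + g)" "Q = cnj (f * g)" by (simp_all add: P_def Q_def)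
    thus "P = 2 * W" "Q = W\<^sup>2 + of_real k" unfolding fg W_def by simp_all
  qed (simp_all add: p_def q_def fg)
  define L where "L x = 1 - P * x + Q * x\<^sup>2" for x
  have form: "L x * y\<^sup>2 + (2 * x - p - P * x\<^sup>2 + 2 * (W * w - of_real n) * x) * y + (x\<^sup>2 - p * x + q) = 0"
    if "chord_tangent k n w x y" for x y
    using that unfolding chord_tangent_def L_def PQ W_def[symmetric] by algebra
  have sym: "chord_tangent k n w x y \<longleftrightarrow> chord_tangent k n w y x" for x y
    unfolding chord_tangent_def by (simp add: ac_simps)
  have vieta: "L x * (y + y') = - (2 * x - p - P * x\<^sup>2 + 2 * (W * w - of_real n) * x)"
      "L x * (y * y') = x\<^sup>2 - p * x + q"
    if "chord_tangent k n w x y" "chord_tangent k n w x y'" "y \<noteq> y'" for x y y'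
  proof -
    note 1 = form[OF that(1)] form[OF that(2)]
    have "(y - y') * (L x * (y + y') + (2 * x - p - P * x\<^sup>2 + 2 * (W * w - of_real n) * x)) = 0"
      using 1 by algebra
    thus a: "L x * (y + y') = - (2 * x - p - P * x\<^sup>2 + 2 * (W * w - of_real n) * x)"
      using that(3) by (simp add: add_eq_0_iff2)
    show "L x * (y * y') = x\<^sup>2 - p * x + q" using 1 a by algebra
  qed
  have vu: "L u * (v + z) = - (2 * u - p - P * u\<^sup>2 + 2 * (W * w - of_real n) * u)"
    and pu: "L u * (v * z) = u\<^sup>2 - p * u + q"
    using vieta[of u v z] t sym ne by auto
  have pv: "L v * (u * z) = v\<^sup>2 - p * v + q"
    using vieta[of v u z] t sym ne by auto
  \<comment> \<open>The Blaschke cubic minus the cubic with roots u, v, z is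
    \<open>\<alpha> * x\<^sup>2 - \<beta> * x\<close>; it vanishes at two distinct nonzero points,
    so both coefficients are zero.\<close>
  define \<alpha> \<beta> where "\<alpha> = u + v + z - p - Q * l" and "\<beta> = u * v + v * z + z * u - q - P * l"
  have nz: "u \<noteq> 0" "v \<noteq> 0" using u v by auto
  have "u * (\<alpha> * u - \<beta>) = 0" "v * (\<alpha> * v - \<beta>) = 0"
    using pu pv unfolding \<alpha>_def \<beta>_def L_def l_def by algebra+
  hence ab: "\<alpha> * u - \<beta> = 0" "\<alpha> * v - \<beta> = 0" using nz by simp_all
  hence "\<alpha> * (u - v) = 0" by algebra
  hence \<alpha>: "\<alpha> = 0" using ne by simp
  hence \<beta>: "\<beta> = 0" using ab by simp
  show "blaschke_triple f g u v z"
    unfolding blaschke_triple_def using \<alpha> \<beta> u v z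
    unfolding \<alpha>_def \<beta>_def p_def q_def P_def Q_def l_def diff_diff_eq right_minus_eq by simp
  have vz: "v + z = p + Q * l - u" using \<alpha> unfolding \<alpha>_def by algebra
  have "L u * l = u * (u\<^sup>2 - p * u + q)" using pu unfolding l_def by algebra
  hence "u * (q * Q - p * P + 1 + 2 * (W * w - of_real n)) = 0"
    using vu unfolding vz L_def by algebra
  hence "q * Q - p * P + 1 + 2 * (W * w - of_real n) = 0" using nz mult_eq_0_iff by blast
  hence "q * Q = p * P - 1 - 2 * (W * w - of_real n)" by algebra
  also have "\<dots> = 2 * (w * W) + 2 * of_real n - 1" unfolding PQ by algebra
  also have "q * Q = of_real ((cmod (f * g))\<^sup>2)"
    unfolding q_def Q_def complex_norm_square by simp
  also have "w * W = of_real ((cmod w)\<^sup>2)"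
    unfolding W_def complex_norm_square by simp
  finally have "complex_of_real ((cmod (f * g))\<^sup>2) = of_real (2 * (cmod w)\<^sup>2 + 2 * n - 1)"
    by simp
  thus "(cmod (f * g))\<^sup>2 = 2 * (cmod w)\<^sup>2 + 2 * n - 1" by (simp only: of_real_eq_iff)
qed

text \<open>The converse of \<open>chord_tangent_triple\<close>: the cubic gives the product v z,
  the closure condition \<open>cl\<close> gives the sum v + z, and so v is a root of the quadratic
  for tangent chords from u.\<close>

lemma blaschke_triple_chord_tangent:
  assumes T: "blaschke_triple f g u v z"
    and fg: "f + g = 2 * w" "f * g = w\<^sup>2 + of_real k"
    and cl: "(cmod (f * g))\<^sup>2 = 2 * (cmod w)\<^sup>2 + 2 * n - 1"
  shows "chord_tangent k n w u v"
proof -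
  define W where "W = cnj w"
  define p q P Q l where "p = f + g" and "q = f * g" and "P = cnj f + cnj g" and "Q = cnj f * cnj g"
    and "l = u * v * z"
  have PQ: "P = 2 * W" "Q = W\<^sup>2 + of_real k" "p = 2 * w" "q = w\<^sup>2 + of_real k"
  proof -
    have "P = cnj (f + g)" "Q = cnj (f * g)" by (simp_all add: P_def Q_def)
    thus "P = 2 * W" "Q = W\<^sup>2 + of_real k" unfolding fg W_def by simp_all
  qed (simp_all add: p_def q_def fg)
  have "complex_of_real ((cmod (f * g))\<^sup>2) = of_real (2 * (cmod w)\<^sup>2 + 2 * n - 1)"
    using cl by simp
  hence "f * g * cnj (f * g) = 2 * (w * cnj w) + 2 * of_real n - 1"
    by (simp only: complex_norm_square of_real_diff of_real_add of_real_mult of_real_1 of_real_numeral)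
  hence qQ: "q * Q = 2 * (w * W) + 2 * of_real n - 1"
    by (simp add: q_def Q_def W_def)
  have e: "u + v + z = p + Q * l" "u * v + v * z + z * u = q + P * l"
    using T unfolding blaschke_triple_def p_def q_def P_def Q_def l_def by simp_all
  define L where "L = 1 - P * u + Q * u\<^sup>2"
  have root: "L * l = u * (u\<^sup>2 - p * u + q)"
    using e unfolding L_def l_def by algebra
  have nz: "u \<noteq> 0" using T by (auto simp: blaschke_triple_def)
  have "u * (L * (v * z) - (u\<^sup>2 - p * u + q)) = 0" using root unfolding l_def by algebra
  hence pr: "L * (v * z) = u\<^sup>2 - p * u + q" using nz by simp
  have vz: "v + z = p + Q * l - u" using e by algebra
  have "L * (v + z) = L * (p - u) + Q * (u * (u\<^sup>2 - p * u + q))"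
    unfolding vz root[symmetric] by (simp add: algebra_simps)
  also have "\<dots> = - (2 * u - p - P * u\<^sup>2 + 2 * (W * w - of_real n) * u)"
    using qQ unfolding L_def PQ(1,3) by algebra
  finally have sm: "L * (v + z) = - (2 * u - p - P * u\<^sup>2 + 2 * (W * w - of_real n) * u)" .
  have "L * v\<^sup>2 + (2 * u - p - P * u\<^sup>2 + 2 * (W * w - of_real n) * u) * v + (u\<^sup>2 - p * u + q) = 0"
    using sm pr by algebra
  thus ?thesis
    unfolding chord_tangent_def W_def[symmetric] L_def PQ by algebra
qed

section \<open>Passing between Poncelet triangles and Blaschke triples\<close>

lemma ellipse_eq_image:
  assumes "a > 0" "b > 0"
  shows "ellipse a b = ept a b ` {u. cmod u = 1}"
proof (intro equalityI subsetI)
  fix X assume "X \<in> ellipse a b"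
  hence X: "(fst X)\<^sup>2 / a\<^sup>2 + (snd X)\<^sup>2 / b\<^sup>2 = 1"
    by (auto simp: ellipse_def)
  define u where "u = Complex (fst X / a) (snd X / b)"
  have "(cmod u)\<^sup>2 = 1"
    using X by (simp add: cmod_power2 u_def power_divide)
  hence "cmod u = 1" by (metis abs_norm_cancel real_sqrt_abs real_sqrt_one)
  moreover have "X = ept a b u" using assms by (simp add: ept_def u_def)
  ultimately show "X \<in> ept a b ` {u. cmod u = 1}" by blast
next
  fix X assume "X \<in> ept a b ` {u. cmod u = 1}"
  then obtain u where "cmod u = 1" and X: "X = ept a b u" by blast
  hence "(Re u)\<^sup>2 + (Im u)\<^sup>2 = 1" by (metis cmod_power2 one_power2)
  thus "X \<in> ellipse a b"
    using assms by (simp add: X ellipse_def ept_def power_mult_distrib)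
qed

lemma ept_in_interior_iff:
  assumes "a > 0" "b > 0"
  shows "ept a b z \<in> ellipse_interior a b \<longleftrightarrow> (cmod z)\<^sup>2 < 1"
  using assms by (simp add: ellipse_interior_def ept_def power_mult_distrib cmod_power2)

lemma nondegenerate_ept:
  assumes "a > 0" "b > 0" and "cmod u = 1" "cmod v = 1" "cmod z = 1"
    and ne: "u \<noteq> v" "v \<noteq> z" "z \<noteq> u"
  shows "nondegenerate (ept a b u, ept a b v, ept a b z)"
proof -
  define U V Z where "U = cnj u" and "V = cnj v" and "Z = cnj z"
  have 1: "u * U = 1" "v * V = 1" "z * Z = 1" using assms by (simp_all add: unit_cnj U_def V_def Z_def)
  define d where "d = (Re v - Re u) * (Im z - Im u) - (Im v - Im u) * (Re z - Re u)"
  have "2 * \<i> * of_real d = (V - U) * (z - u) - (v - u) * (Z - U)"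
    unfolding d_def of_real_mult of_real_diff complex_parts
      U_def[symmetric] V_def[symmetric] Z_def[symmetric]
    by (simp add: field_simps)
  also have "\<dots> = (v - u) * (z - u) * (v - z) * (U * V * Z)"
    using 1 by algebra
  also have "\<dots> \<noteq> 0" using ne 1 by auto
  finally have "d \<noteq> 0" by auto
  moreover have "cross2 (ept a b u) (ept a b v) (ept a b z) = a * b * d"
    by (simp add: cross2_def ept_def d_def algebra_simps)
  ultimately show ?thesis using assms(1,2) unfolding nondegenerate_iff by simp
qed

text \<open>The circle of radius \<open>r\<close> about \<open>ept a b w\<close> becomes, after scaling the ellipse to the unit circle,
  an ellipse with foci \<open>caustic_focus a b w r\<close> and \<open>caustic_focus a b w (- r)\<close>.\<close>
definition caustic_focus :: "real \<Rightarrow> real \<Rightarrow> complex \<Rightarrow> real \<Rightarrow> complex" where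
  "caustic_focus a b w r = w + \<i> * of_real (r * sqrt (a\<^sup>2 - b\<^sup>2) / (a * b))"

text \<open>Poncelet closure for triangles: the condition on the radius \<open>r\<close> under which the tangents from a
  point of the ellipse to the circle about \<open>ept a b w\<close> cut off a third side that is tangent as well.\<close>
definition porism_condition :: "real \<Rightarrow> real \<Rightarrow> complex \<Rightarrow> real \<Rightarrow> bool" where
  "porism_condition a b w r \<longleftrightarrow> (cmod (caustic_focus a b w r * caustic_focus a b w (- r)))\<^sup>2 =
     2 * (cmod w)\<^sup>2 + 2 * (r\<^sup>2 * (a\<^sup>2 + b\<^sup>2) / (a\<^sup>2 * b\<^sup>2)) - 1"

locale ellipse_axes =
  fixes a b :: real
  assumes ab: "b > 0" "a > b"
begin

lemma a_pos: "a > 0" using ab by linarith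

lemma csq_pos: "a\<^sup>2 - b\<^sup>2 > 0" using ab by (simp add: power_strict_mono)

lemma caustic_focus_sum: "caustic_focus a b w r + caustic_focus a b w (- r) = 2 * w"
  by (simp add: caustic_focus_def)

lemma caustic_focus_prod:
  "caustic_focus a b w r * caustic_focus a b w (- r) =
   w\<^sup>2 + of_real (r\<^sup>2 * (a\<^sup>2 - b\<^sup>2) / (a\<^sup>2 * b\<^sup>2))"
proof -
  have "a\<^sup>2 - b\<^sup>2 \<ge> 0" using ab by (simp add: power_mono)
  hence "(r * sqrt (a\<^sup>2 - b\<^sup>2) / (a * b))\<^sup>2 = r\<^sup>2 * (a\<^sup>2 - b\<^sup>2) / (a\<^sup>2 * b\<^sup>2)"
    by (simp add: power_mult_distrib power_divide)
  moreover have "caustic_focus a b w r * caustic_focus a b w (- r) = w\<^sup>2 + of_real ((r * sqrt (a\<^sup>2 - b\<^sup>2) / (a * b))\<^sup>2)"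
    unfolding caustic_focus_def of_real_power by (simp add: power2_eq_square algebra_simps)
  ultimately show ?thesis by simp
qed

text \<open>The highest and the lowest point of the circle scale to w + i r / b and w - i r / b. The
  foci lie on the segment between them because sqrt (a^2 - b^2) is at most a, and adding the two
  inequalities bounds r.\<close>

lemma sphere_inside_ellipse:
  assumes r: "r > 0" and sub: "sphere (ept a b w) r \<subseteq> ellipse_interior a b"
  shows "cmod (caustic_focus a b w r) < 1" "cmod (caustic_focus a b w (- r)) < 1" "r\<^sup>2 < b\<^sup>2 * (1 - (cmod w)\<^sup>2)"
proof -
  have vert: "(Re w)\<^sup>2 + (Im w + e * (r / b))\<^sup>2 < 1" if "e = 1 \<or> e = - 1" for e
  proof -
    have "ept a b (w + \<i> * of_real (e * (r / b))) = ept a b w + (0, e * r)"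
      using ab by (simp add: ept_def algebra_simps)
    moreover have "ept a b w + (0, e * r) \<in> sphere (ept a b w) r"
      using r that by (auto simp: dist_norm norm_prod_def)
    ultimately have "ept a b (w + \<i> * of_real (e * (r / b))) \<in> ellipse_interior a b"
      using sub by auto
    hence "(cmod (w + \<i> * of_real (e * (r / b))))\<^sup>2 < 1"
      using ab ept_in_interior_iff[of a b] by simp
    thus ?thesis by (simp add: cmod_power2)
  qed
  have v1: "(Re w)\<^sup>2 + (Im w)\<^sup>2 + 2 * Im w * (r / b) + (r / b)\<^sup>2 < 1"
    using vert[of 1] by (simp add: power2_eq_square algebra_simps)
  have v2: "(Re w)\<^sup>2 + (Im w)\<^sup>2 - 2 * Im w * (r / b) + (r / b)\<^sup>2 < 1"
    using vert[of "- 1"] by (simp add: power2_eq_square algebra_simps)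
  have "(r / b)\<^sup>2 < 1 - (cmod w)\<^sup>2" unfolding cmod_power2 using v1 v2 by linarith
  thus "r\<^sup>2 < b\<^sup>2 * (1 - (cmod w)\<^sup>2)" using ab by (simp add: power_divide field_simps)
  define \<kappa> where "\<kappa> = r * sqrt (a\<^sup>2 - b\<^sup>2) / (a * b)"
  have "sqrt (a\<^sup>2 - b\<^sup>2) \<le> sqrt (a\<^sup>2)" by (rule real_sqrt_le_mono) simp
  hence "sqrt (a\<^sup>2 - b\<^sup>2) \<le> a" using ab by simp
  hence k: "\<kappa> \<le> r / b" unfolding \<kappa>_def using ab r by (simp add: field_simps)
  have k0: "0 \<le> \<kappa>" unfolding \<kappa>_def using ab r by (simp add: power_mono)
  have "\<kappa>\<^sup>2 \<le> (r / b)\<^sup>2" using k k0 by (rule power_mono)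
  moreover have "\<bar>Im w * \<kappa>\<bar> \<le> \<bar>Im w * (r / b)\<bar>"
    using k k0 ab r unfolding abs_mult by (intro mult_left_mono) auto
  ultimately have "(Re w)\<^sup>2 + (Im w + \<kappa>)\<^sup>2 < 1" "(Re w)\<^sup>2 + (Im w - \<kappa>)\<^sup>2 < 1"
    using v1 v2 unfolding power2_sum power2_diff mult.assoc by linarith+
  hence "(cmod (caustic_focus a b w r))\<^sup>2 < 1" "(cmod (caustic_focus a b w (- r)))\<^sup>2 < 1"
    unfolding caustic_focus_def cmod_power2 by (simp_all add: \<kappa>_def)
  thus "cmod (caustic_focus a b w r) < 1" "cmod (caustic_focus a b w (- r)) < 1"
    by (simp_all add: power_less_one_iff abs_square_less_1)
qed

lemma poncelet_family_imp_blaschke: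
  assumes "(P, Q, R) \<in> poncelet_family a b (ept a b w)"
  obtains r u v z where "r > 0" "sphere (ept a b w) r \<subseteq> ellipse_interior a b"
    "P = ept a b u" "Q = ept a b v" "R = ept a b z"
    "blaschke_triple (caustic_focus a b w r) (caustic_focus a b w (- r)) u v z" "porism_condition a b w r"
proof -
  obtain r where nd: "nondegenerate (P, Q, R)" and ins: "P \<in> ellipse a b" "Q \<in> ellipse a b" "R \<in> ellipse a b"
    and r: "r > 0" and sub: "sphere (ept a b w) r \<subseteq> ellipse_interior a b"
    and tan: "sides_tangent_to (P, Q, R) (ept a b w) r"
    using assms unfolding poncelet_family_def by auto
  have a: "a > 0" using ab by linarith
  obtain u v z where u: "cmod u = 1" "P = ept a b u" and v: "cmod v = 1" "Q = ept a b v"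
    and z: "cmod z = 1" "R = ept a b z"
    using ins unfolding ellipse_eq_image[OF a ab(1)] by blast
  have ne: "u \<noteq> v" "v \<noteq> z" "z \<noteq> u" using nondegenerate_distinct[OF nd] u v z by auto
  define k n where "k = r\<^sup>2 * (a\<^sup>2 - b\<^sup>2) / (a\<^sup>2 * b\<^sup>2)" and "n = r\<^sup>2 * (a\<^sup>2 + b\<^sup>2) / (a\<^sup>2 * b\<^sup>2)"
  have "chord_tangent k n w u v" "chord_tangent k n w v z" "chord_tangent k n w z u"
    using tan unfolding sides_tangent_iff[OF nd r] k_def n_def unfolding u(2) v(2) z(2)
    by (simp_all only: chord_tangent_iff[OF a ab(1) u(1) v(1) ne(1)]
        chord_tangent_iff[OF a ab(1) v(1) z(1) ne(2)] chord_tangent_iff[OF a ab(1) z(1) u(1) ne(3)])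
  note bl = chord_tangent_triple[OF u(1) v(1) z(1) ne this caustic_focus_sum[of w r] caustic_focus_prod[of w r, folded k_def]]
  show ?thesis
    by (rule that[OF r sub u(2) v(2) z(2) bl(1)]) (use bl(2) in \<open>simp add: porism_condition_def n_def\<close>)
qed

lemma blaschke_tangent:
  assumes r: "r > 0" and sub: "sphere (ept a b w) r \<subseteq> ellipse_interior a b"
    and T: "blaschke_triple (caustic_focus a b w r) (caustic_focus a b w (- r)) u v z" and cl: "porism_condition a b w r"
  shows "nondegenerate (ept a b u, ept a b v, ept a b z)"
    and "sides_tangent_to (ept a b u, ept a b v, ept a b z) (ept a b w) r"
proof -
  have a: "a > 0" using ab by linarith
  note ne = blaschke_triple_distinct[OF T sphere_inside_ellipse(1,2)[OF r sub]]
  have 1: "cmod u = 1" "cmod v = 1" "cmod z = 1" using T by (simp_all add: blaschke_triple_def)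
  show nd: "nondegenerate (ept a b u, ept a b v, ept a b z)"
    by (rule nondegenerate_ept[OF a ab(1) 1 ne])
  note ch = blaschke_triple_chord_tangent[OF _ caustic_focus_sum caustic_focus_prod cl[unfolded porism_condition_def]]
  show "sides_tangent_to (ept a b u, ept a b v, ept a b z) (ept a b w) r"
    unfolding sides_tangent_iff[OF nd r] chord_tangent_iff[OF a ab(1) 1(1,2) ne(1)]
      chord_tangent_iff[OF a ab(1) 1(2,3) ne(2)] chord_tangent_iff[OF a ab(1) 1(3,1) ne(3)]
    using ch[OF T] ch[OF blaschke_triple_rotate[OF T]] ch[OF blaschke_triple_rotate[OF blaschke_triple_rotate[OF T]]]
    by blast
qed

lemma blaschke_imp_poncelet_family:
  assumes r: "r > 0" and sub: "sphere (ept a b w) r \<subseteq> ellipse_interior a b"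
    and T: "blaschke_triple (caustic_focus a b w r) (caustic_focus a b w (- r)) u v z" and cl: "porism_condition a b w r"
  shows "(ept a b u, ept a b v, ept a b z) \<in> poncelet_family a b (ept a b w)"
proof -
  have a: "a > 0" using ab by linarith
  have "cmod u = 1" "cmod v = 1" "cmod z = 1" using T by (simp_all add: blaschke_triple_def)
  hence "ept a b u \<in> ellipse a b" "ept a b v \<in> ellipse a b" "ept a b z \<in> ellipse a b"
    unfolding ellipse_eq_image[OF a ab(1)] by auto
  thus ?thesis
    unfolding poncelet_family_def using blaschke_tangent[OF assms] r sub by auto
qed

lemma blaschke_is_incircle:
  assumes r: "r > 0" and sub: "sphere (ept a b w) r \<subseteq> ellipse_interior a b"
    and T: "blaschke_triple (caustic_focus a b w r) (caustic_focus a b w (- r)) u v z" and cl: "porism_condition a b w r"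
  shows "is_incircle (ept a b u, ept a b v, ept a b z) (ept a b w) r"
proof -
  obtain \<alpha> \<beta> \<gamma> :: real where pos: "\<alpha> > 0" "\<beta> > 0" "\<gamma> > 0" "\<alpha> + \<beta> + \<gamma> = 1"
    and "(caustic_focus a b w r + caustic_focus a b w (- r)) / 2 = of_real \<alpha> * u + of_real \<beta> * v + of_real \<gamma> * z"
    using blaschke_triple_foci_midpoint[OF T sphere_inside_ellipse(1,2)[OF r sub]] .
  hence "w = of_real \<alpha> * u + of_real \<beta> * v + of_real \<gamma> * z" unfolding caustic_focus_sum by simp
  hence "ept a b w = \<alpha> *\<^sub>R ept a b u + \<beta> *\<^sub>R ept a b v + \<gamma> *\<^sub>R ept a b z"
    by (simp only: ept_linear)
  hence "ept a b w \<in> convex hull {ept a b u, ept a b v, ept a b z}"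
    unfolding convex_hull_3 using pos less_imp_le by blast
  thus ?thesis using blaschke_tangent(2)[OF assms] r by simp
qed

text \<open>The closure condition is a quadratic equation in r^2 whose roots have product (M / e)^2,
  whereas a circle inside the ellipse has e r^2 < M. So two different roots cannot both be
  admissible.\<close>

lemma porism_radius_unique:
  assumes r: "r > 0" "sphere (ept a b w) r \<subseteq> ellipse_interior a b" "porism_condition a b w r"
    and s: "s > 0" "sphere (ept a b w) s \<subseteq> ellipse_interior a b" "porism_condition a b w s"
  shows "r = s"
proof -
  define e d where "e = (a\<^sup>2 - b\<^sup>2) / (a\<^sup>2 * b\<^sup>2)" and "d = (a\<^sup>2 + b\<^sup>2) / (a\<^sup>2 * b\<^sup>2)"
  have "a\<^sup>2 - b\<^sup>2 > 0" using ab by (simp add: power_strict_mono)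
  hence e: "e > 0" using ab by (simp add: e_def)
  have eb: "e * b\<^sup>2 < 1" using ab by (simp add: e_def field_simps)
  define M where "M = 1 - (cmod w)\<^sup>2"
  have quad: "e\<^sup>2 * (x\<^sup>2)\<^sup>2 + 2 * (e * ((Re w)\<^sup>2 - (Im w)\<^sup>2) - d) * x\<^sup>2 + M\<^sup>2 = 0" if "porism_condition a b w x" for x
  proof -
    have "x\<^sup>2 * (a\<^sup>2 - b\<^sup>2) / (a\<^sup>2 * b\<^sup>2) = x\<^sup>2 * e" "x\<^sup>2 * (a\<^sup>2 + b\<^sup>2) / (a\<^sup>2 * b\<^sup>2) = x\<^sup>2 * d"
      by (simp_all add: e_def d_def)
    hence "(cmod (w\<^sup>2 + of_real (x\<^sup>2 * e)))\<^sup>2 = 2 * (cmod w)\<^sup>2 + 2 * (x\<^sup>2 * d) - 1"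
      using that unfolding porism_condition_def caustic_focus_prod by simp
    thus ?thesis
      unfolding M_def cmod_power2 by (simp add: power2_eq_square algebra_simps)
  qed
  have small: "0 < e * x\<^sup>2" "e * x\<^sup>2 < M" if "x > 0" "sphere (ept a b w) x \<subseteq> ellipse_interior a b" for x
  proof -
    show "0 < e * x\<^sup>2" using e that by simp
    have lt: "x\<^sup>2 < b\<^sup>2 * M" unfolding M_def by (rule sphere_inside_ellipse(3)[OF that])
    hence "0 < b\<^sup>2 * M" using that(1) by (meson less_trans zero_less_power)
    hence "M > 0" using ab by (simp add: zero_less_mult_iff)
    have "e * x\<^sup>2 < e * (b\<^sup>2 * M)" using lt e by simp
    also have "\<dots> = (e * b\<^sup>2) * M" by simp
    also have "\<dots> < 1 * M" using eb \<open>M > 0\<close> by (rule mult_strict_right_mono)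
    finally show "e * x\<^sup>2 < M" by simp
  qed
  have "r\<^sup>2 = s\<^sup>2"
  proof (rule ccontr)
    assume "r\<^sup>2 \<noteq> s\<^sup>2"
    moreover have "(r\<^sup>2 - s\<^sup>2) * ((e * r\<^sup>2) * (e * s\<^sup>2) - M * M) = 0"
      using quad[OF r(3)] quad[OF s(3)] by algebra
    ultimately have "(e * r\<^sup>2) * (e * s\<^sup>2) = M * M" by simp
    moreover have "(e * r\<^sup>2) * (e * s\<^sup>2) < M * M"
      using small[OF r(1,2)] small[OF s(1,2)] by (intro mult_strict_mono') auto
    ultimately show False by simp
  qed
  thus ?thesis using r(1) s(1) by (simp add: power2_eq_iff_nonneg)
qed

end

text \<open>Division of the cubic by z, with 1 / z = cnj z, expresses Re (z^2) as an affine function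
  of z. On the unit circle the squared norm of \<open>ept a b z\<close> is affine in Re (z^2), so
  completing squares gives a circle about (h, k) through the images of all three roots.\<close>

lemma circumcircle_of_blaschke_root:
  assumes "a > 0" "b > 0" and z: "cmod z = 1"
    and root: "z^3 - e1 * z^2 + e2 * z - l = 0"
    and h: "4 * a * h = (a\<^sup>2 - b\<^sup>2) * (Re e1 + Re l)" and k: "4 * b * k = (a\<^sup>2 - b\<^sup>2) * (Im l - Im e1)"
  shows "(dist (ept a b z) (h, k))\<^sup>2 = h\<^sup>2 + k\<^sup>2 + (a\<^sup>2 + b\<^sup>2) / 2 - (a\<^sup>2 - b\<^sup>2) / 2 * Re e2"
proof -
  have zz: "z * cnj z = 1" by (rule unit_cnj[OF z])
  have n: "(Re z)\<^sup>2 + (Im z)\<^sup>2 = 1" using z by (metis cmod_power2 one_power2)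
  have "z^2 - e1 * z + e2 - l * cnj z = 0"
    using root zz by algebra
  hence "Re (z^2 - e1 * z + e2 - l * cnj z) = 0" by simp
  hence q: "(Re z)\<^sup>2 - (Im z)\<^sup>2 - (Re e1 * Re z - Im e1 * Im z) + Re e2 - (Re l * Re z + Im l * Im z) = 0"
    by (simp add: power2_eq_square)
  have "4 * (dist (ept a b z) (h, k))\<^sup>2 = 4 * (a\<^sup>2 * (Re z)\<^sup>2 + b\<^sup>2 * (Im z)\<^sup>2)
      - 2 * ((4 * a * h) * Re z + (4 * b * k) * Im z) + 4 * (h\<^sup>2 + k\<^sup>2)"
    unfolding point_dist_sq ept_def by (simp add: power2_eq_square algebra_simps)
  also have "\<dots> = 4 * (h\<^sup>2 + k\<^sup>2) + 2 * (a\<^sup>2 + b\<^sup>2) - 2 * (a\<^sup>2 - b\<^sup>2) * Re e2"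
    unfolding h k using q n by algebra
  finally show ?thesis by (simp add: field_simps)
qed

section \<open>Centers on the ellipse of centroids\<close>

text \<open>The center C in the coordinates in which the ellipse is the unit circle.\<close>

definition locus_center :: "real \<Rightarrow> real \<Rightarrow> real \<Rightarrow> complex" where
  "locus_center a b t =
     Complex ((a\<^sup>2 - b\<^sup>2) * cos t / (a\<^sup>2 + 3 * b\<^sup>2)) ((a\<^sup>2 - b\<^sup>2) * sin t / (3 * a\<^sup>2 + b\<^sup>2))"

text \<open>In terms of C = (x, y) this is (x / a^2, - y / b^2), the direction from C to the
  Feuerbach point.\<close>

definition euler_dir :: "real \<Rightarrow> real \<Rightarrow> real \<Rightarrow> point" where
  "euler_dir a b t = (Re (locus_center a b t) / a, - (Im (locus_center a b t) / b))"

text \<open>With \<open>C\<close> the common incenter, the Feuerbach point of the family is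
  \<open>C + feuerbach_shift a b *\<^sub>R euler_dir a b t\<close>.\<close>
definition feuerbach_shift :: "real \<Rightarrow> real \<Rightarrow> real" where
  "feuerbach_shift a b = 2 * a\<^sup>2 * b\<^sup>2 / (a\<^sup>2 - b\<^sup>2)"

text \<open>A candidate, namely the distance from C to the expected Feuerbach point.
  \<open>porism_locus\<close>, \<open>locus_incircle_inside\<close> and
  \<open>porism_radius_unique\<close> identify it as the radius of the family.\<close>

definition locus_inradius :: "real \<Rightarrow> real \<Rightarrow> real \<Rightarrow> real" where
  "locus_inradius a b t = feuerbach_shift a b * norm (euler_dir a b t)"

abbreviation family_triple :: "real \<Rightarrow> real \<Rightarrow> real \<Rightarrow> complex \<Rightarrow> complex \<Rightarrow> complex \<Rightarrow> bool" where
  "family_triple a b t \<equiv> blaschke_triple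
     (caustic_focus a b (locus_center a b t) (locus_inradius a b t))
     (caustic_focus a b (locus_center a b t) (- locus_inradius a b t))"

text \<open>With \<open>l\<close> the product of the three unit numbers of a triangle, its Euler center is
  \<open>C - euler_shift a b t l *\<^sub>R euler_dir a b t\<close>.\<close>
definition euler_shift :: "real \<Rightarrow> real \<Rightarrow> real \<Rightarrow> complex \<Rightarrow> real" where
  "euler_shift a b t l = (1 - Re (cis (- t) * l)) * (a\<^sup>2 - b\<^sup>2) / 4"

context ellipse_axes
begin

section \<open>The caustic for a center on the ellipse of centroids\<close>

lemma denominators_pos: "a\<^sup>2 + 3 * b\<^sup>2 > 0" "3 * a\<^sup>2 + b\<^sup>2 > 0"
  using ab a_pos by (simp_all add: add_pos_pos)

lemma locus_center_parts:
  "(a\<^sup>2 + 3 * b\<^sup>2) * Re (locus_center a b t) = (a\<^sup>2 - b\<^sup>2) * cos t"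
  "(3 * a\<^sup>2 + b\<^sup>2) * Im (locus_center a b t) = (a\<^sup>2 - b\<^sup>2) * sin t"
  using denominators_pos by (simp_all add: locus_center_def)

lemma locus_center_conic:
  "((a\<^sup>2 + 3 * b\<^sup>2) * Re (locus_center a b t))\<^sup>2 + ((3 * a\<^sup>2 + b\<^sup>2) * Im (locus_center a b t))\<^sup>2 =
   (a\<^sup>2 - b\<^sup>2)\<^sup>2"
proof -
  have "(cos t)\<^sup>2 + (sin t)\<^sup>2 = 1" by simp
  thus ?thesis unfolding locus_center_parts[of t] by algebra
qed

lemma locus_center_nonzero: "locus_center a b t \<noteq> 0"
  using locus_center_conic[of t] csq_pos by auto

lemma euler_dir_nonzero: "euler_dir a b t \<noteq> 0"
  using locus_center_nonzero[of t] ab a_pos by (auto simp: euler_dir_def complex_eq_iff prod_eq_iff)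

lemma feuerbach_shift_pos:
  "feuerbach_shift a b > 0"
  using csq_pos ab a_pos by (simp add: feuerbach_shift_def)

lemma locus_inradius_pos:
  "locus_inradius a b t > 0"
  using feuerbach_shift_pos euler_dir_nonzero[of t] by (simp add: locus_inradius_def)

lemma feuerbach_shift_eq: "(a\<^sup>2 - b\<^sup>2) * feuerbach_shift a b = 2 * a\<^sup>2 * b\<^sup>2"
  using csq_pos by (simp add: feuerbach_shift_def)

lemma norm_euler_dir_sq:
  "a\<^sup>2 * b\<^sup>2 * (norm (euler_dir a b t))\<^sup>2 =
   b\<^sup>2 * (Re (locus_center a b t))\<^sup>2 + a\<^sup>2 * (Im (locus_center a b t))\<^sup>2"
  using ab a_pos by (simp add: euler_dir_def point_norm_sq power_divide field_simps)

lemma locus_inradius_sq: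
  "(a\<^sup>2 - b\<^sup>2)\<^sup>2 * (locus_inradius a b t)\<^sup>2 =
   4 * a\<^sup>2 * b\<^sup>2 * (b\<^sup>2 * (Re (locus_center a b t))\<^sup>2 + a\<^sup>2 * (Im (locus_center a b t))\<^sup>2)"
proof -
  have "(a\<^sup>2 - b\<^sup>2)\<^sup>2 * (locus_inradius a b t)\<^sup>2 = ((a\<^sup>2 - b\<^sup>2) * feuerbach_shift a b)\<^sup>2 * (norm (euler_dir a b t))\<^sup>2"
    unfolding locus_inradius_def by (simp add: power_mult_distrib)
  also have "\<dots> = 4 * (a\<^sup>2 * b\<^sup>2) * (a\<^sup>2 * b\<^sup>2 * (norm (euler_dir a b t))\<^sup>2)"
    unfolding feuerbach_shift_eq by (simp add: power2_eq_square)
  finally show ?thesis unfolding norm_euler_dir_sq[of t] by (simp add: mult.assoc)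
qed

lemma focal_term_eq:
  "(locus_inradius a b t)\<^sup>2 * (a\<^sup>2 - b\<^sup>2) / (a\<^sup>2 * b\<^sup>2) =
   4 * (b\<^sup>2 * (Re (locus_center a b t))\<^sup>2 + a\<^sup>2 * (Im (locus_center a b t))\<^sup>2) / (a\<^sup>2 - b\<^sup>2)"
proof -
  have "x * d / p = 4 * y / d" if "d\<^sup>2 * x = 4 * p * y" "d \<noteq> 0" "p \<noteq> 0" for x d p y :: real
    using that by (simp add: field_simps power2_eq_square)
  thus ?thesis using locus_inradius_sq[of t] csq_pos ab a_pos by (simp add: mult.assoc)
qed

lemma porism_term_eq:
  "2 * ((locus_inradius a b t)\<^sup>2 * (a\<^sup>2 + b\<^sup>2) / (a\<^sup>2 * b\<^sup>2)) =
   1 - (cmod (locus_center a b t))\<^sup>2"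
proof -
  define d where "d = a\<^sup>2 - b\<^sup>2"
  have d: "d \<noteq> 0" using csq_pos by (simp add: d_def)
  have pq: "a\<^sup>2 * b\<^sup>2 \<noteq> 0" using ab by simp
  have "d\<^sup>2 * (a\<^sup>2 * b\<^sup>2 * (1 - (cmod (locus_center a b t))\<^sup>2)) = d\<^sup>2 * (2 * (locus_inradius a b t)\<^sup>2 * (a\<^sup>2 + b\<^sup>2))"
    using locus_inradius_sq[of t] locus_center_conic[of t] unfolding cmod_power2 d_def by algebra
  hence "a\<^sup>2 * b\<^sup>2 * (1 - (cmod (locus_center a b t))\<^sup>2) = 2 * (locus_inradius a b t)\<^sup>2 * (a\<^sup>2 + b\<^sup>2)" using d by simp
  moreover have "2 * (x * y / g) = z" if "g * z = 2 * x * y" "g \<noteq> 0" for g x y z :: real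
    using that by (simp add: field_simps)
  ultimately show ?thesis using pq by blast
qed

text \<open>The identity that makes l = cis t the parameter of an equilateral triangle. It also
  gives the product of the foci the modulus of the scaled center, which reduces the closure
  condition to \<open>porism_term_eq\<close>.\<close>

lemma caustic_focus_locus_prod:
  "caustic_focus a b (locus_center a b t) (locus_inradius a b t) *
   caustic_focus a b (locus_center a b t) (- locus_inradius a b t) = cnj (locus_center a b t) * cis t"
proof -
  define w X Y d where "w = locus_center a b t" and "X = Re w" and "Y = Im w" and "d = a\<^sup>2 - b\<^sup>2"
  have d: "d \<noteq> 0" using csq_pos by (simp add: d_def)
  have c: "cos t = (a\<^sup>2 + 3 * b\<^sup>2) * X / d" "sin t = (3 * a\<^sup>2 + b\<^sup>2) * Y / d"
    using locus_center_parts[of t] csq_pos by (simp_all add: X_def Y_def w_def d_def)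
  have "w\<^sup>2 + of_real (4 * (b\<^sup>2 * X\<^sup>2 + a\<^sup>2 * Y\<^sup>2) / d) = cnj w * cis t"
  proof (rule complex_eqI)
    have "X\<^sup>2 - Y\<^sup>2 + 4 * (b\<^sup>2 * X\<^sup>2 + a\<^sup>2 * Y\<^sup>2) / d =
        X * ((a\<^sup>2 + 3 * b\<^sup>2) * X / d) + Y * ((3 * a\<^sup>2 + b\<^sup>2) * Y / d)"
      using d apply (simp add: field_simps) unfolding d_def by algebra
    thus "Re (w\<^sup>2 + of_real (4 * (b\<^sup>2 * X\<^sup>2 + a\<^sup>2 * Y\<^sup>2) / d)) = Re (cnj w * cis t)"
      by (simp add: c Re_power2 flip: X_def Y_def)
    have "2 * X * Y = X * ((3 * a\<^sup>2 + b\<^sup>2) * Y / d) - Y * ((a\<^sup>2 + 3 * b\<^sup>2) * X / d)"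
      using d apply (simp add: field_simps) unfolding d_def by algebra
    thus "Im (w\<^sup>2 + of_real (4 * (b\<^sup>2 * X\<^sup>2 + a\<^sup>2 * Y\<^sup>2) / d)) = Im (cnj w * cis t)"
      by (simp add: c Im_power2 flip: X_def Y_def)
  qed
  thus ?thesis unfolding caustic_focus_prod focal_term_eq[of t] X_def Y_def d_def w_def .
qed

lemma porism_locus: "porism_condition a b (locus_center a b t) (locus_inradius a b t)"
proof -
  have "cmod (cnj (locus_center a b t) * cis t) = cmod (locus_center a b t)" by (simp add: norm_mult)
  thus ?thesis unfolding porism_condition_def caustic_focus_locus_prod porism_term_eq[of t] by simp
qed

lemma locus_incircle_inside:
  "sphere (ept a b (locus_center a b t)) (locus_inradius a b t) \<subseteq> ellipse_interior a b"
proof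
  fix P assume P: "P \<in> sphere (ept a b (locus_center a b t)) (locus_inradius a b t)"
  obtain x y where xy: "P = (x, y)" by (cases P)
  define X Y where "X = Re (locus_center a b t)" and "Y = Im (locus_center a b t)"
  have on: "(x - a * X)\<^sup>2 + (y - b * Y)\<^sup>2 = (locus_inradius a b t)\<^sup>2"
  proof -
    have "(dist P (ept a b (locus_center a b t)))\<^sup>2 = (locus_inradius a b t)\<^sup>2" using P by (simp add: dist_commute)
    thus ?thesis unfolding point_dist_sq by (simp add: xy ept_def X_def Y_def)
  qed
  define p q where "p = a\<^sup>2" and "q = b\<^sup>2"
  have pq: "q > 0" "p > q" using ab by (simp_all add: p_def q_def power_strict_mono)
  have p0: "p > 0" "p + 2 * q > 0" "(p - q)\<^sup>2 > 0" using pq by simp_all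
  have conic: "((p + 3 * q) * X)\<^sup>2 + ((3 * p + q) * Y)\<^sup>2 = (p - q)\<^sup>2"
    using locus_center_conic[of t] by (simp add: p_def q_def X_def Y_def)
  have r: "(p - q)\<^sup>2 * (locus_inradius a b t)\<^sup>2 = 4 * p * q * (q * X\<^sup>2 + p * Y\<^sup>2)"
    using locus_inradius_sq[of t] by (simp add: p_def q_def X_def Y_def)
  define T where "T = (3 * p + 2 * q) / (2 * p * q)"
  \<comment> \<open>(p - q)^2 times the constant left by completing the squares, less the
    contribution of the circle equation. Replacing (p - q)^2 by means of \<open>conic\<close> makes
    it a diagonal quadratic form in X and Y, positive since q < p.\<close>
  define K where "K = (12 * p\<^sup>2 * q + 48 * p * q\<^sup>2 - 6 * q^3) * X\<^sup>2 / (9 * p) + (12 * p\<^sup>2 * q + 6 * p * q\<^sup>2) * Y\<^sup>2 / (p + 2 * q)"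
  have XY: "X \<noteq> 0 \<or> Y \<noteq> 0" using locus_center_nonzero[of t] by (auto simp: X_def Y_def complex_eq_iff)
  have pos1: "12 * p\<^sup>2 * q + 48 * p * q\<^sup>2 - 6 * q^3 > 0"
  proof -
    have "q * q\<^sup>2 < p * q\<^sup>2" using pq by simp
    moreover have "0 < p\<^sup>2 * q" "0 < p * q\<^sup>2" using pq p0 by simp_all
    ultimately show ?thesis by (simp add: power3_eq_cube power2_eq_square)
  qed
  have pos2: "12 * p\<^sup>2 * q + 6 * p * q\<^sup>2 > 0" using pq p0 by (simp add: add_pos_pos)
  have K: "K > 0"
  proof (cases "X = 0")
    case True
    hence "Y\<^sup>2 > 0" using XY by simp
    thus ?thesis unfolding K_def True using pos2 p0 by simp
  next
    case False
    hence "X\<^sup>2 > 0" by simp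
    hence "(12 * p\<^sup>2 * q + 48 * p * q\<^sup>2 - 6 * q^3) * X\<^sup>2 / (9 * p) > 0" using pos1 p0 by simp
    moreover have "(12 * p\<^sup>2 * q + 6 * p * q\<^sup>2) * Y\<^sup>2 / (p + 2 * q) \<ge> 0" using pos2 p0 by simp
    ultimately show ?thesis unfolding K_def by linarith
  qed
  txt \<open>S-procedure: adding \<open>T\<close> times the equation of the circle turns \<open>1 - x\<^sup>2 / p - y\<^sup>2 / q\<close> into a sum of
    squares plus a positive constant. The value of \<open>T\<close> is the one that maximizes the margin of the \<open>Y\<^sup>2\<close> part.\<close>
  have id: "(p - q)\<^sup>2 * (1 - x\<^sup>2 / p - y\<^sup>2 / q) =
     (p - q)\<^sup>2 * (3 / (2 * q) * (x - (3 * p + 2 * q) / (3 * p) * (a * X))\<^sup>2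
       + (p + 2 * q) / (2 * p * q) * (y - (3 * p + 2 * q) / (p + 2 * q) * (b * Y))\<^sup>2) + K"
  proof -
    have one: "(p - q)\<^sup>2 = (p + 3 * q)\<^sup>2 * X\<^sup>2 + (3 * p + q)\<^sup>2 * Y\<^sup>2"
      using conic by (simp add: power_mult_distrib)
    have rr: "(p - q)\<^sup>2 * ((x - a * X)\<^sup>2 + (y - b * Y)\<^sup>2) = 4 * p * q * (q * X\<^sup>2 + p * Y\<^sup>2)"
      using r on by simp
    have ex: "1 - x\<^sup>2 / p - y\<^sup>2 / q + T * ((x - a * X)\<^sup>2 + (y - b * Y)\<^sup>2) =
      3 / (2 * q) * (x - (3 * p + 2 * q) / (3 * p) * (a * X))\<^sup>2
       + (p + 2 * q) / (2 * p * q) * (y - (3 * p + 2 * q) / (p + 2 * q) * (b * Y))\<^sup>2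
       + (1 - (3 * p + 2 * q) / (3 * p) * X\<^sup>2 - (3 * p + 2 * q) / (p + 2 * q) * Y\<^sup>2)"
    proof -
      have 1: "- x\<^sup>2 / p + T * (x - g)\<^sup>2 = 3 / (2 * q) * (x - (3 * p + 2 * q) / (3 * p) * g)\<^sup>2 - (3 * p + 2 * q) / (3 * p) * (g\<^sup>2 / p)" for g
        unfolding T_def using p0 pq by (simp add: field_simps power2_eq_square)
      have 2: "- y\<^sup>2 / q + T * (y - g)\<^sup>2 = (p + 2 * q) / (2 * p * q) * (y - (3 * p + 2 * q) / (p + 2 * q) * g)\<^sup>2 - (3 * p + 2 * q) / (p + 2 * q) * (g\<^sup>2 / q)" for g
      proof -
        \<comment> \<open>Stated for a free \<open>s\<close>, so that the denominator p + 2 q is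
          cleared as a single nonzero factor.\<close>
        have gen: "- y\<^sup>2 / q + (s + 2 * p) / (2 * p * q) * (y - g)\<^sup>2 =
            s / (2 * p * q) * (y - (s + 2 * p) / s * g)\<^sup>2 - (s + 2 * p) / s * (g\<^sup>2 / q)"
          if "s \<noteq> 0" "p \<noteq> 0" "q \<noteq> 0" for s p q :: real
          using that by (simp add: field_simps power2_eq_square)
        have e: "3 * p + 2 * q = p + 2 * q + 2 * p" by simp
        show ?thesis unfolding T_def e by (rule gen) (use p0 pq in auto)
      qed
      have 3: "(a * X)\<^sup>2 / p = X\<^sup>2" "(b * Y)\<^sup>2 / q = Y\<^sup>2"
        using ab a_pos by (simp_all add: p_def q_def power_mult_distrib)
      show ?thesis using 1[of "a * X", unfolded 3] 2[of "b * Y", unfolded 3] by (simp add: algebra_simps)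
    qed
    have KK: "(p - q)\<^sup>2 * (1 - (3 * p + 2 * q) / (3 * p) * X\<^sup>2 - (3 * p + 2 * q) / (p + 2 * q) * Y\<^sup>2)
       - T * (4 * p * q * (q * X\<^sup>2 + p * Y\<^sup>2)) = K"
    proof -
      define s where "s = p + 2 * q"
      have s: "s \<noteq> 0" "p \<noteq> 0" "q \<noteq> 0" using p0 pq by (auto simp: s_def)
      have TT: "T * (4 * p * q * (q * X\<^sup>2 + p * Y\<^sup>2)) = 2 * (3 * p + 2 * q) * (q * X\<^sup>2 + p * Y\<^sup>2)"
        unfolding T_def using s by (simp add: field_simps)
      have 1: "(p + 3 * q)\<^sup>2 - 2 * (3 * p + 2 * q) * q - (p - q)\<^sup>2 * ((3 * p + 2 * q) / (3 * p)) =
          (12 * p\<^sup>2 * q + 48 * p * q\<^sup>2 - 6 * q^3) / (9 * p)"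
        using s by (simp add: field_simps power2_eq_square power3_eq_cube)
      have 2: "(3 * p + q)\<^sup>2 - 2 * (3 * p + 2 * q) * p - (p - q)\<^sup>2 * ((3 * p + 2 * q) / s) =
          (12 * p\<^sup>2 * q + 6 * p * q\<^sup>2) / s"
        using s apply (simp add: field_simps) unfolding s_def by algebra
      have "(p - q)\<^sup>2 * (1 - (3 * p + 2 * q) / (3 * p) * X\<^sup>2 - (3 * p + 2 * q) / s * Y\<^sup>2)
         - 2 * (3 * p + 2 * q) * (q * X\<^sup>2 + p * Y\<^sup>2) =
         ((p + 3 * q)\<^sup>2 - 2 * (3 * p + 2 * q) * q - (p - q)\<^sup>2 * ((3 * p + 2 * q) / (3 * p))) * X\<^sup>2 +
         ((3 * p + q)\<^sup>2 - 2 * (3 * p + 2 * q) * p - (p - q)\<^sup>2 * ((3 * p + 2 * q) / s)) * Y\<^sup>2"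
        using one by algebra
      thus ?thesis unfolding TT K_def s_def[symmetric] unfolding 1 2 by simp
    qed
    show ?thesis using ex rr KK by algebra
  qed
  have "(p - q)\<^sup>2 * (1 - x\<^sup>2 / p - y\<^sup>2 / q) > 0"
    unfolding id using p0 pq K by (intro add_nonneg_pos mult_nonneg_nonneg add_nonneg_nonneg) auto
  hence "1 - x\<^sup>2 / p - y\<^sup>2 / q > 0" using p0 by (simp add: zero_less_mult_iff)
  thus "P \<in> ellipse_interior a b" by (simp add: xy ellipse_interior_def p_def q_def)
qed

text \<open>Any admissible radius equals \<open>locus_inradius a b t\<close>, so the existential
  quantifier over radii disappears and the family consists of the Blaschke triples of one fixed pair
  of foci.\<close>

lemma family_iff:
  "(P, Q, R) \<in> poncelet_family a b (ept a b (locus_center a b t)) \<longleftrightarrow>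
     (\<exists>u v z. P = ept a b u \<and> Q = ept a b v \<and> R = ept a b z \<and>
        family_triple a b t u v z)"
proof
  assume "(P, Q, R) \<in> poncelet_family a b (ept a b (locus_center a b t))"
  then obtain r u v z where "r > 0" "sphere (ept a b (locus_center a b t)) r \<subseteq> ellipse_interior a b"
    and P: "P = ept a b u" "Q = ept a b v" "R = ept a b z"
    and bl: "blaschke_triple (caustic_focus a b (locus_center a b t) r) (caustic_focus a b (locus_center a b t) (- r)) u v z"
    and "porism_condition a b (locus_center a b t) r"
    by (rule poncelet_family_imp_blaschke)
  hence "r = locus_inradius a b t"
    by (intro porism_radius_unique[of r "locus_center a b t" "locus_inradius a b t"] locus_inradius_pos locus_incircle_inside porism_locus)
  thus "\<exists>u v z. P = ept a b u \<and> Q = ept a b v \<and> R = ept a b z \<and>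
        family_triple a b t u v z"
    using P bl by blast
next
  assume "\<exists>u v z. P = ept a b u \<and> Q = ept a b v \<and> R = ept a b z \<and>
        family_triple a b t u v z"
  thus "(P, Q, R) \<in> poncelet_family a b (ept a b (locus_center a b t))"
    using blaschke_imp_poncelet_family[OF locus_inradius_pos locus_incircle_inside _ porism_locus] by blast
qed

section \<open>Euler center, Feuerbach point and X80 over the family\<close>

lemma euler_shift_bounds:
  assumes "cmod l = 1"
  shows "0 \<le> euler_shift a b t l" "euler_shift a b t l \<le> (a\<^sup>2 - b\<^sup>2) / 2"
proof -
  have d: "a\<^sup>2 - b\<^sup>2 \<ge> 0" using csq_pos by simp
  have "cmod (cis (- t) * l) = 1" using assms by (simp add: norm_mult)
  hence m: "\<bar>Re (cis (- t) * l)\<bar> \<le> 1" by (metis abs_Re_le_cmod)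
  show "0 \<le> euler_shift a b t l" unfolding euler_shift_def using d m by simp
  have "(1 - Re (cis (- t) * l)) * (a\<^sup>2 - b\<^sup>2) \<le> 2 * (a\<^sup>2 - b\<^sup>2)"
    using d m by (intro mult_right_mono) auto
  thus "euler_shift a b t l \<le> (a\<^sup>2 - b\<^sup>2) / 2" unfolding euler_shift_def by linarith
qed

lemma blaschke_centroid:
  assumes T: "family_triple a b t u v z"
  shows "u + v + z = locus_center a b t * (2 + cis (- t) * (u * v * z))"
proof -
  have "cnj (caustic_focus a b (locus_center a b t) (locus_inradius a b t)) * cnj (caustic_focus a b (locus_center a b t) (- locus_inradius a b t)) = locus_center a b t * cis (- t)"
    using arg_cong[OF caustic_focus_locus_prod[of t], of cnj] by (simp add: cis_cnj)
  thus ?thesis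
    using T unfolding blaschke_triple_def caustic_focus_sum by (simp add: algebra_simps)
qed

text \<open>With \<mu> = cis (- t) u v z and w the scaled center, the vertices sum to 2 C +
  \<open>ept a b (w * \<mu>)\<close>, and the circumcenter (h, k) is
  \<open>ept a b (w * \<mu>)\<close> + 2 \<delta> \<open>euler_dir a b t\<close>. The common term
  cancels in twice the Euler center, and with it Im \<mu>, so the Euler center moves on a
  line.\<close>

lemma nine_point_circle_of_family:
  assumes T: "family_triple a b t u v z"
  shows "is_nine_point_circle (ept a b u, ept a b v, ept a b z) N s \<longleftrightarrow>
    N = ept a b (locus_center a b t) - euler_shift a b t (u * v * z) *\<^sub>R euler_dir a b t \<and>
    s = (feuerbach_shift a b + euler_shift a b t (u * v * z)) * norm (euler_dir a b t)"
proof -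
  define w d l \<mu> where "w = locus_center a b t" and "d = a\<^sup>2 - b\<^sup>2" and "l = u * v * z" and "\<mu> = cis (- t) * l"
  define X Y m n where "X = Re w" and "Y = Im w" and "m = Re \<mu>" and "n = Im \<mu>"
  define e1 e2 where "e1 = w * (2 + \<mu>)" and "e2 = cnj w * cis t * (1 + 2 * \<mu>)"
  have a: "a > 0" using ab by linarith
  have d: "d > 0" using csq_pos by (simp add: d_def)
  have unit: "cmod u = 1" "cmod v = 1" "cmod z = 1" using T by (simp_all add: blaschke_triple_def)
  have l: "l = cis t * \<mu>" by (simp add: \<mu>_def cis_mult flip: mult.assoc)
  have "cmod \<mu> = 1" using unit by (simp add: \<mu>_def l_def norm_mult)
  hence mn: "m\<^sup>2 + n\<^sup>2 = 1" unfolding m_def n_def by (metis cmod_power2 one_power2)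
  note fp = caustic_focus_locus_prod[of t, folded w_def] and fs = caustic_focus_sum[of w "locus_inradius a b t"]
  have cfs: "cnj (caustic_focus a b w (locus_inradius a b t)) + cnj (caustic_focus a b w (- locus_inradius a b t)) = 2 * cnj w"
    using arg_cong[OF fs, of cnj] by simp
  have e1: "u + v + z = e1"
    unfolding e1_def \<mu>_def l_def w_def by (rule blaschke_centroid[OF T])
  have e2: "u * v + v * z + z * u = e2"
    using T unfolding blaschke_triple_def w_def[symmetric] fp cfs l_def[symmetric] e2_def l
    by (simp add: algebra_simps)
  have wp: "(a\<^sup>2 + 3 * b\<^sup>2) * X = d * cos t" "(3 * a\<^sup>2 + b\<^sup>2) * Y = d * sin t"
    using locus_center_parts[of t] by (simp_all add: X_def Y_def w_def d_def)
  have conic: "((a\<^sup>2 + 3 * b\<^sup>2) * X)\<^sup>2 + ((3 * a\<^sup>2 + b\<^sup>2) * Y)\<^sup>2 = d\<^sup>2"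
    using locus_center_conic[of t] by (simp add: X_def Y_def w_def d_def)
  have re: "Re e1 = X * (2 + m) - Y * n" "Im e1 = X * n + Y * (2 + m)"
    by (simp_all add: e1_def X_def Y_def m_def n_def)
  have rl: "d * Re l = (a\<^sup>2 + 3 * b\<^sup>2) * X * m - (3 * a\<^sup>2 + b\<^sup>2) * Y * n"
    "d * Im l = (a\<^sup>2 + 3 * b\<^sup>2) * X * n + (3 * a\<^sup>2 + b\<^sup>2) * Y * m"
    unfolding l wp by (simp_all add: m_def n_def algebra_simps)
  have re2: "d * Re e2 = ((a\<^sup>2 + 3 * b\<^sup>2) * X\<^sup>2 + (3 * a\<^sup>2 + b\<^sup>2) * Y\<^sup>2) * (1 + 2 * m) - 4 * d * X * Y * n"
  proof -
    have "Re e2 = (X * cos t + Y * sin t) * (1 + 2 * m) - (X * sin t - Y * cos t) * (2 * n)"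
      by (simp add: e2_def X_def Y_def m_def n_def algebra_simps)
    thus ?thesis using wp unfolding d_def by algebra
  qed
  define h k where "h = a * (X * m - Y * n) + (1 - m) * d * X / (2 * a)"
    and "k = b * (X * n + Y * m) - (1 - m) * d * Y / (2 * b)"
  have h2: "2 * a * h = 2 * a\<^sup>2 * (X * m - Y * n) + (1 - m) * d * X"
    using a unfolding h_def by (simp add: field_simps power2_eq_square)
  have k2: "2 * b * k = 2 * b\<^sup>2 * (X * n + Y * m) - (1 - m) * d * Y"
    using ab unfolding k_def by (simp add: field_simps power2_eq_square)
  have h: "4 * a * h = (a\<^sup>2 - b\<^sup>2) * (Re e1 + Re l)"
    using h2 rl(1) unfolding re d_def by algebra
  have k: "4 * b * k = (a\<^sup>2 - b\<^sup>2) * (Im l - Im e1)"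
    using k2 rl(2) unfolding re d_def by algebra
  define \<delta> where "\<delta> = euler_shift a b t l"
  have \<delta>: "4 * \<delta> = (1 - m) * d"
    by (simp add: \<delta>_def euler_shift_def m_def \<mu>_def d_def)
  define \<rho> where "\<rho> = 2 * ((feuerbach_shift a b + \<delta>) * norm (euler_dir a b t))"
  have "0 \<le> \<delta>" unfolding \<delta>_def using unit by (intro euler_shift_bounds) (simp add: l_def norm_mult)
  hence \<rho>0: "\<rho> \<ge> 0" unfolding \<rho>_def using feuerbach_shift_pos by simp
  \<comment> \<open>A polynomial identity after multiplication by 4 p q d^2. The relation
    \<open>conic\<close> rewrites the term free of X and Y, so that both sides are quadratic forms
    in X and Y; n^2 = 1 - m^2 does the rest.\<close>
  have rad: "h\<^sup>2 + k\<^sup>2 + (a\<^sup>2 + b\<^sup>2) / 2 - (a\<^sup>2 - b\<^sup>2) / 2 * Re e2 = \<rho>\<^sup>2"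
  proof -
    define p q where "p = a\<^sup>2" and "q = b\<^sup>2"
    have pq: "p > 0" "q > 0" using a ab by (simp_all add: p_def q_def)
    have nd: "p * q * (norm (euler_dir a b t))\<^sup>2 = q * X\<^sup>2 + p * Y\<^sup>2"
      using norm_euler_dir_sq[of t] by (simp add: p_def q_def X_def Y_def w_def)
    have dqe: "d * feuerbach_shift a b = 2 * p * q" using feuerbach_shift_eq by (simp add: p_def q_def d_def)
    have dd: "4 * (d * (feuerbach_shift a b + \<delta>)) = 8 * p * q + (1 - m) * d\<^sup>2"
      using dqe \<delta> by algebra
    have R: "4 * p * q * d\<^sup>2 * \<rho>\<^sup>2 = (8 * p * q + (1 - m) * d\<^sup>2)\<^sup>2 * (q * X\<^sup>2 + p * Y\<^sup>2)"
      unfolding \<rho>_def dd[symmetric] nd[symmetric] by (simp add: power2_eq_square)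
    have hh: "4 * p * h\<^sup>2 = (2 * p * (X * m - Y * n) + (1 - m) * d * X)\<^sup>2"
      unfolding p_def h2[symmetric] by (simp add: power2_eq_square)
    have kk: "4 * q * k\<^sup>2 = (2 * q * (X * n + Y * m) - (1 - m) * d * Y)\<^sup>2"
      unfolding q_def k2[symmetric] by (simp add: power2_eq_square)
    have c: "((p + 3 * q) * X)\<^sup>2 + ((3 * p + q) * Y)\<^sup>2 = d\<^sup>2" using conic by (simp add: p_def q_def)
    have re2': "d * Re e2 = ((p + 3 * q) * X\<^sup>2 + (3 * p + q) * Y\<^sup>2) * (1 + 2 * m) - 4 * d * X * Y * n"
      using re2 by (simp add: p_def q_def)
    have dpq: "d = p - q" by (simp add: d_def p_def q_def)
    have n2: "n\<^sup>2 = 1 - m\<^sup>2" using mn by simp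
    have "4 * p * q * d\<^sup>2 * (h\<^sup>2 + k\<^sup>2 + (p + q) / 2 - d / 2 * Re e2) =
      q * d\<^sup>2 * (4 * p * h\<^sup>2) + p * d\<^sup>2 * (4 * q * k\<^sup>2) + 2 * p * q * (p + q) * d\<^sup>2 - 2 * p * q * d\<^sup>2 * (d * Re e2)"
      by (simp add: field_simps power2_eq_square)
    also have "\<dots> = q * d\<^sup>2 * (2 * p * (X * m - Y * n) + (1 - m) * d * X)\<^sup>2
       + p * d\<^sup>2 * (2 * q * (X * n + Y * m) - (1 - m) * d * Y)\<^sup>2
       + 2 * p * q * (p + q) * (((p + 3 * q) * X)\<^sup>2 + ((3 * p + q) * Y)\<^sup>2)
       - 2 * p * q * d\<^sup>2 * (((p + 3 * q) * X\<^sup>2 + (3 * p + q) * Y\<^sup>2) * (1 + 2 * m) - 4 * d * X * Y * n)"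
      unfolding hh kk re2' c by simp
    also have "\<dots> = (8 * p * q + (1 - m) * d\<^sup>2)\<^sup>2 * (q * X\<^sup>2 + p * Y\<^sup>2)"
      unfolding dpq using n2 by algebra
    also have "\<dots> = 4 * p * q * d\<^sup>2 * \<rho>\<^sup>2" using R by simp
    finally have "4 * p * q * d\<^sup>2 * (h\<^sup>2 + k\<^sup>2 + (p + q) / 2 - d / 2 * Re e2) = 4 * p * q * d\<^sup>2 * \<rho>\<^sup>2" .
    moreover have "4 * p * q * d\<^sup>2 \<noteq> 0" using pq d by simp
    ultimately have "h\<^sup>2 + k\<^sup>2 + (p + q) / 2 - d / 2 * Re e2 = \<rho>\<^sup>2" by (metis mult_cancel_left)
    thus ?thesis by (simp add: p_def q_def d_def)
  qed
  have dist: "dist (ept a b x) (h, k) = \<rho>" if "(x - u) * (x - v) * (x - z) = 0" "cmod x = 1" for x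
  proof -
    have "x^3 - e1 * x^2 + e2 * x - l = (x - u) * (x - v) * (x - z)"
      unfolding e1[symmetric] e2[symmetric] l_def by algebra
    hence "x^3 - e1 * x^2 + e2 * x - l = 0" using that by simp
    from circumcircle_of_blaschke_root[OF a ab(1) that(2) this h k]
    have "(dist (ept a b x) (h, k))\<^sup>2 = \<rho>\<^sup>2" unfolding rad .
    thus ?thesis using \<rho>0 by (simp add: power2_eq_iff_nonneg)
  qed
  have nd: "nondegenerate (ept a b u, ept a b v, ept a b z)"
    by (rule blaschke_tangent(1)[OF locus_inradius_pos locus_incircle_inside T porism_locus])
  have "is_nine_point_circle (ept a b u, ept a b v, ept a b z) N s \<longleftrightarrow>
      2 *\<^sub>R N = ept a b u + ept a b v + ept a b z - (h, k) \<and> 2 * s = \<rho>"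
    by (rule nine_point_circle_iff[OF nd]) (use dist[of u] dist[of v] dist[of z] unit in auto)
  also have "ept a b u + ept a b v + ept a b z - (h, k) = 2 *\<^sub>R (ept a b w - \<delta> *\<^sub>R euler_dir a b t)"
  proof -
    have 1: "ept a b u + ept a b v + ept a b z = ept a b e1" unfolding e1[symmetric] by (simp add: ept_linear)
    have \<delta>': "\<delta> = (1 - m) * d / 4" using \<delta> by simp
    have "\<delta> * 2 / a * X = (1 - m) * d * X / (2 * a)" "\<delta> * 2 / b * Y = (1 - m) * d * Y / (2 * b)"
      unfolding \<delta>' using a ab by (simp_all add: field_simps)
    thus ?thesis
      unfolding 1 unfolding ept_def re h_def k_def euler_dir_def w_def[symmetric] X_def[symmetric] Y_def[symmetric]
      by (intro prod_eqI) (simp_all add: algebra_simps)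
  qed
  also have "(2 *\<^sub>R N = 2 *\<^sub>R (ept a b w - \<delta> *\<^sub>R euler_dir a b t) \<and> 2 * s = \<rho>) \<longleftrightarrow>
     N = ept a b w - \<delta> *\<^sub>R euler_dir a b t \<and> s = (feuerbach_shift a b + \<delta>) * norm (euler_dir a b t)"
    unfolding \<rho>_def by simp
  finally show ?thesis unfolding w_def \<delta>_def l_def .
qed

text \<open>If the triangle is equilateral, incenter and centroid agree, which forces \<mu> = 1.
  Conversely, at shift zero \<mu> = 1, so C is the centroid and the nine-point circle is the
  incircle; the homothety of ratio - 2 about C puts all vertices at equal distance from C.\<close>

lemma equilateral_iff_no_shift:
  assumes T: "family_triple a b t u v z"
  shows "equilateral (ept a b u, ept a b v, ept a b z) \<longleftrightarrow> euler_shift a b t (u * v * z) = 0"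
proof -
  define C \<mu> where "C = ept a b (locus_center a b t)" and "\<mu> = cis (- t) * (u * v * z)"
  have a: "a > 0" using ab by linarith
  have d: "a\<^sup>2 - b\<^sup>2 > 0" by (rule csq_pos)
  have nd: "nondegenerate (ept a b u, ept a b v, ept a b z)"
    by (rule blaschke_tangent(1)[OF locus_inradius_pos locus_incircle_inside T porism_locus])
  have inc: "is_incircle (ept a b u, ept a b v, ept a b z) C (locus_inradius a b t)"
    unfolding C_def by (rule blaschke_is_incircle[OF locus_inradius_pos locus_incircle_inside T porism_locus])
  have sum: "u + v + z = locus_center a b t * (2 + \<mu>)"
    unfolding \<mu>_def by (rule blaschke_centroid[OF T])
  have unit: "cmod \<mu> = 1" using T by (simp add: \<mu>_def norm_mult blaschke_triple_def)
  have shift: "euler_shift a b t (u * v * z) = 0 \<longleftrightarrow> Re \<mu> = 1"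
    using d by (simp add: euler_shift_def \<mu>_def)
  have C3: "3 *\<^sub>R C = ept a b (3 * locus_center a b t)"
    unfolding C_def using ept_linear(3)[of a b 3] by simp
  show ?thesis
  proof
    assume "equilateral (ept a b u, ept a b v, ept a b z)"
    hence "3 *\<^sub>R C = ept a b u + ept a b v + ept a b z"
      by (rule equilateral_incenter[OF nd inc])
    hence "ept a b (3 * locus_center a b t) = ept a b (locus_center a b t * (2 + \<mu>))"
      unfolding C3 sum[symmetric] by (simp add: ept_linear)
    hence "3 * locus_center a b t = locus_center a b t * (2 + \<mu>)"
      using a ab by (simp add: ept_def complex_eq_iff)
    hence "locus_center a b t * (\<mu> - 1) = 0" by algebra
    hence "\<mu> = 1" using locus_center_nonzero by simp
    thus "euler_shift a b t (u * v * z) = 0" unfolding shift by simp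
  next
    assume 0: "euler_shift a b t (u * v * z) = 0"
    hence "Re \<mu> = 1" unfolding shift .
    moreover have "(Re \<mu>)\<^sup>2 + (Im \<mu>)\<^sup>2 = 1" using unit by (metis cmod_power2 one_power2)
    ultimately have "\<mu> = 1" by (simp add: complex_eq_iff)
    hence "u + v + z = 3 * locus_center a b t" using sum by simp
    hence cen: "3 *\<^sub>R C = ept a b u + ept a b v + ept a b z"
      unfolding C3 by (metis ept_linear(1))
    have "is_nine_point_circle (ept a b u, ept a b v, ept a b z) C (locus_inradius a b t)"
      unfolding nine_point_circle_of_family[OF T] 0 C_def locus_inradius_def by simp
    hence mid: "midpoint (ept a b u) (ept a b v) \<in> sphere C (locus_inradius a b t)"
      "midpoint (ept a b v) (ept a b z) \<in> sphere C (locus_inradius a b t)"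
      "midpoint (ept a b z) (ept a b u) \<in> sphere C (locus_inradius a b t)"
      by simp_all
    have vert: "dist R C = 2 * locus_inradius a b t" if "midpoint P Q \<in> sphere C (locus_inradius a b t)" "3 *\<^sub>R C = P + Q + R" for P Q R :: point
    proof -
      have R: "R = 3 *\<^sub>R C - P - Q" using that(2) by simp
      have "R - C = 2 *\<^sub>R (C - midpoint P Q)"
        unfolding R by (intro prod_eqI) (simp_all add: midpoint_def field_simps)
      hence "dist R C = 2 * dist C (midpoint P Q)" by (simp add: dist_norm)
      thus ?thesis using that(1) by simp
    qed
    show "equilateral (ept a b u, ept a b v, ept a b z)"
      by (rule centroid_circumcenter_equilateral[OF cen vert[OF mid(2)] vert[OF mid(3)] vert[OF mid(1)]])
        (simp_all add: cen add_ac)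
  qed
qed

lemma feuerbach_iff:
  assumes T: "family_triple a b t u v z"
  shows "is_feuerbach_point (ept a b u, ept a b v, ept a b z) p \<longleftrightarrow>
    \<not> equilateral (ept a b u, ept a b v, ept a b z) \<and> p = ept a b (locus_center a b t) + feuerbach_shift a b *\<^sub>R euler_dir a b t"
proof -
  define C \<delta> where "C = ept a b (locus_center a b t)" and "\<delta> = euler_shift a b t (u * v * z)"
  have nd: "nondegenerate (ept a b u, ept a b v, ept a b z)"
    by (rule blaschke_tangent(1)[OF locus_inradius_pos locus_incircle_inside T porism_locus])
  have inc: "is_incircle (ept a b u, ept a b v, ept a b z) C (locus_inradius a b t)"
    unfolding C_def by (rule blaschke_is_incircle[OF locus_inradius_pos locus_incircle_inside T porism_locus])
  have iff: "is_incircle (ept a b u, ept a b v, ept a b z) I r \<longleftrightarrow> I = C \<and> r = locus_inradius a b t" for I r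
    using inc incircle_unique[OF nd inc] by blast
  have "is_feuerbach_point (ept a b u, ept a b v, ept a b z) p \<longleftrightarrow>
      sphere C (feuerbach_shift a b * norm (euler_dir a b t)) \<inter> sphere (C - \<delta> *\<^sub>R euler_dir a b t) ((feuerbach_shift a b + \<delta>) * norm (euler_dir a b t)) = {p}"
    unfolding is_feuerbach_point_def iff nine_point_circle_of_family[OF T] C_def[symmetric] \<delta>_def[symmetric]
      locus_inradius_def[symmetric] by simp
  also have "\<dots> \<longleftrightarrow> \<delta> \<noteq> 0 \<and> p = C + feuerbach_shift a b *\<^sub>R euler_dir a b t"
  proof (cases "\<delta> = 0")
    \<comment> \<open>The two circles coincide, and a circle with the two antipodal points along
      \<open>euler_dir a b t\<close> is not a singleton.\<close>
    case True
    have "C + e *\<^sub>R euler_dir a b t \<in> sphere C (feuerbach_shift a b * norm (euler_dir a b t))" if "e = feuerbach_shift a b \<or> e = - feuerbach_shift a b" for e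
      using that feuerbach_shift_pos by (auto simp: dist_norm)
    moreover have "C + feuerbach_shift a b *\<^sub>R euler_dir a b t \<noteq> C + (- feuerbach_shift a b) *\<^sub>R euler_dir a b t"
      using feuerbach_shift_pos euler_dir_nonzero[of t] by (simp add: eq_neg_iff_add_eq_0 flip: scaleR_left.add)
    ultimately have "sphere C (feuerbach_shift a b * norm (euler_dir a b t)) \<noteq> {p}" by (metis singletonD)
    thus ?thesis using True by simp
  next
    case False
    have "cmod (u * v * z) = 1" using T by (simp add: norm_mult blaschke_triple_def)
    hence "\<delta> \<ge> 0" unfolding \<delta>_def by (rule euler_shift_bounds(1))
    hence "\<delta> > 0" using False by simp
    thus ?thesis
      using internally_tangent_spheres[OF feuerbach_shift_pos \<open>\<delta> > 0\<close>, of C "euler_dir a b t"] by auto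
  qed
  finally show ?thesis unfolding equilateral_iff_no_shift[OF T] C_def \<delta>_def .
qed

lemma X80_iff:
  assumes T: "family_triple a b t u v z"
  shows "is_X80 (ept a b u, ept a b v, ept a b z) p \<longleftrightarrow>
    \<not> equilateral (ept a b u, ept a b v, ept a b z) \<and> p = ept a b (locus_center a b t) + (2 * feuerbach_shift a b) *\<^sub>R euler_dir a b t"
proof -
  define C where "C = ept a b (locus_center a b t)"
  have nd: "nondegenerate (ept a b u, ept a b v, ept a b z)"
    by (rule blaschke_tangent(1)[OF locus_inradius_pos locus_incircle_inside T porism_locus])
  have inc: "is_incircle (ept a b u, ept a b v, ept a b z) C (locus_inradius a b t)"
    unfolding C_def by (rule blaschke_is_incircle[OF locus_inradius_pos locus_incircle_inside T porism_locus])
  have iff: "is_incircle (ept a b u, ept a b v, ept a b z) I r \<longleftrightarrow> I = C \<and> r = locus_inradius a b t" for I r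
    using inc incircle_unique[OF nd inc] by blast
  have refl: "2 *\<^sub>R (C + feuerbach_shift a b *\<^sub>R euler_dir a b t) - C = C + (2 * feuerbach_shift a b) *\<^sub>R euler_dir a b t"
    by (intro prod_eqI) simp_all
  show ?thesis
    unfolding is_X80_def feuerbach_iff[OF T] C_def[symmetric]
    unfolding iff refl[symmetric] by auto
qed

text \<open>As l = x y z runs through the unit circle, Re (cis (- t) l) covers the interval from - 1
  to 1, so the shift covers the interval from 0 to (a^2 - b^2) / 2. The end C belongs to l = cis
  t.\<close>

lemma euler_locus_family:
  shows "euler_locus (poncelet_family a b (ept a b (locus_center a b t))) =
    closed_segment (ept a b (locus_center a b t)) (ept a b (locus_center a b t) - ((a\<^sup>2 - b\<^sup>2) / 2) *\<^sub>R euler_dir a b t)"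
proof -
  define C v where "C = ept a b (locus_center a b t)" and "v = euler_dir a b t"
  define d where "d = a\<^sup>2 - b\<^sup>2"
  have d: "d > 0" using csq_pos by (simp add: d_def)
  have euler: "is_euler_center (ept a b x, ept a b y, ept a b z) N \<longleftrightarrow> N = C - euler_shift a b t (x * y * z) *\<^sub>R v"
    if "family_triple a b t x y z" for x y z N
    unfolding is_euler_center_def nine_point_circle_of_family[OF that] C_def v_def by simp
  have seg: "closed_segment C (C - (d / 2) *\<^sub>R v) = {C - \<delta> *\<^sub>R v | \<delta>. 0 \<le> \<delta> \<and> \<delta> \<le> d / 2}"
  proof (intro equalityI subsetI)
    fix N assume "N \<in> closed_segment C (C - (d / 2) *\<^sub>R v)"
    then obtain s where s: "0 \<le> s" "s \<le> 1" "N = (1 - s) *\<^sub>R C + s *\<^sub>R (C - (d / 2) *\<^sub>R v)"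
      unfolding closed_segment_def by blast
    have "N = C - (s * (d / 2)) *\<^sub>R v" unfolding s(3) by (simp add: algebra_simps)
    moreover have "0 \<le> s * (d / 2)" "s * (d / 2) \<le> d / 2" using s(1,2) d by simp_all
    ultimately show "N \<in> {C - \<delta> *\<^sub>R v | \<delta>. 0 \<le> \<delta> \<and> \<delta> \<le> d / 2}" by blast
  next
    fix N assume "N \<in> {C - \<delta> *\<^sub>R v | \<delta>. 0 \<le> \<delta> \<and> \<delta> \<le> d / 2}"
    then obtain \<delta> where \<delta>: "0 \<le> \<delta>" "\<delta> \<le> d / 2" "N = C - \<delta> *\<^sub>R v" by blast
    define s where "s = \<delta> / (d / 2)"
    have s: "0 \<le> s" "s \<le> 1" "\<delta> = s * (d / 2)" using \<delta> d by (simp_all add: s_def field_simps)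
    have "N = (1 - s) *\<^sub>R C + s *\<^sub>R (C - (d / 2) *\<^sub>R v)" unfolding \<delta>(3) s(3) by (simp add: algebra_simps)
    thus "N \<in> closed_segment C (C - (d / 2) *\<^sub>R v)" unfolding closed_segment_def using s by blast
  qed
  have "euler_locus (poncelet_family a b C) = {C - \<delta> *\<^sub>R v | \<delta>. 0 \<le> \<delta> \<and> \<delta> \<le> d / 2}"
  proof (intro equalityI subsetI)
    fix N assume "N \<in> euler_locus (poncelet_family a b C)"
    then obtain T where "T \<in> poncelet_family a b C" "is_euler_center T N"
      unfolding euler_locus_def by blast
    moreover obtain P Q R where "T = (P, Q, R)" by (cases T)
    ultimately have mem: "(P, Q, R) \<in> poncelet_family a b C" and N: "is_euler_center (P, Q, R) N"
      by simp_all
    obtain x y z where PQR: "P = ept a b x" "Q = ept a b y" "R = ept a b z"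
      and xyz: "family_triple a b t x y z"
      using mem unfolding C_def family_iff by blast
    have N: "N = C - euler_shift a b t (x * y * z) *\<^sub>R v"
      using N unfolding PQR euler[OF xyz] .
    have "cmod (x * y * z) = 1" using xyz by (simp add: norm_mult blaschke_triple_def)
    thus "N \<in> {C - \<delta> *\<^sub>R v | \<delta>. 0 \<le> \<delta> \<and> \<delta> \<le> d / 2}"
      using N euler_shift_bounds[of "x * y * z" t] unfolding d_def by blast
  next
    fix N assume "N \<in> {C - \<delta> *\<^sub>R v | \<delta>. 0 \<le> \<delta> \<and> \<delta> \<le> d / 2}"
    then obtain \<delta> where \<delta>: "0 \<le> \<delta>" "\<delta> \<le> d / 2" "N = C - \<delta> *\<^sub>R v" by blast
    \<comment> \<open>The value of Re (cis (- t) l) for which the shift is \<delta>; the square root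
      below completes it to a unit number.\<close>
    define m where "m = 1 - 4 * \<delta> / d"
    have "\<bar>m\<bar> \<le> 1" using \<delta> d by (simp add: m_def field_simps abs_le_iff)
    hence m1: "m\<^sup>2 \<le> 1" by (simp add: abs_square_le_1)
    define l where "l = cis t * Complex m (sqrt (1 - m\<^sup>2))"
    have "(cmod (Complex m (sqrt (1 - m\<^sup>2))))\<^sup>2 = 1" using m1 by (simp add: cmod_power2)
    hence "cmod (Complex m (sqrt (1 - m\<^sup>2))) = 1" by (metis abs_norm_cancel real_sqrt_abs real_sqrt_one)
    hence l: "cmod l = 1" by (simp add: l_def norm_mult)
    have "cis (- t) * l = Complex m (sqrt (1 - m\<^sup>2))" by (simp add: l_def cis_mult flip: mult.assoc)
    hence sh: "euler_shift a b t l = \<delta>" using d unfolding euler_shift_def d_def[symmetric] by (simp add: m_def)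
    obtain x y z where bl: "family_triple a b t x y z"
      and "x * y * z = l"
      using blaschke_triple_exists[OF sphere_inside_ellipse(1,2)[OF locus_inradius_pos locus_incircle_inside] l] .
    hence "is_euler_center (ept a b x, ept a b y, ept a b z) N"
      unfolding euler[OF bl] using \<delta>(3) sh by simp
    moreover have "(ept a b x, ept a b y, ept a b z) \<in> poncelet_family a b C"
      unfolding C_def family_iff using bl by blast
    ultimately show "N \<in> euler_locus (poncelet_family a b C)" unfolding euler_locus_def by blast
  qed
  thus ?thesis using seg unfolding C_def v_def d_def by simp
qed

end

theorem proposition15:
  fixes a b c a\<^sub>e\<^sub>q b\<^sub>e\<^sub>q t :: real and C X11 X80 :: point
    and \<T> :: "triangle set" and \<L>\<^sub>5 :: "point set"
  assumes "a > b" and "b > 0" and "c\<^sup>2 = a\<^sup>2 - b\<^sup>2"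
    and "a\<^sub>e\<^sub>q = a * c\<^sup>2 / (a\<^sup>2 + 3 * b\<^sup>2)"
    and "b\<^sub>e\<^sub>q = b * c\<^sup>2 / (3 * a\<^sup>2 + b\<^sup>2)"
    and "C = (a\<^sub>e\<^sub>q * cos t, b\<^sub>e\<^sub>q * sin t)"
    and "\<T> = poncelet_family a b C"
    and "\<L>\<^sub>5 = euler_locus \<T>"
    and "X11 = ((a\<^sup>2 + b\<^sup>2) / c\<^sup>2) *\<^sub>R (a\<^sub>e\<^sub>q * cos t, - b\<^sub>e\<^sub>q * sin t)"
    and "X80 = (a * cos t, - b * sin t)"
  shows "(\<exists>D. D \<noteq> C \<and> \<L>\<^sub>5 = closed_segment C D) \<and>
    (\<forall>T\<in>\<T>. \<forall>p. is_feuerbach_point T p \<longleftrightarrow> \<not> equilateral T \<and> p = X11) \<and>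
    (\<forall>T\<in>\<T>. \<forall>p. is_X80 T p \<longleftrightarrow> \<not> equilateral T \<and> p = X80) \<and>
    (\<exists>r>0. (\<forall>T\<in>\<T>. is_incircle T C r) \<and>
           extension_beyond \<L>\<^sub>5 C \<inter> sphere C r - {C} = {X11}) \<and>
    extension_beyond \<L>\<^sub>5 C \<inter> ellipse a b - {C} = {X80}"
proof -
  interpret ellipse_axes a b using assms(1,2) by unfold_locales
  note a = a_pos
  define w v \<alpha> d where "w = locus_center a b t" and "v = euler_dir a b t" and "\<alpha> = feuerbach_shift a b" and "d = a\<^sup>2 - b\<^sup>2"
  have d: "d > 0" using csq_pos by (simp add: d_def)
  have cd: "c\<^sup>2 = d" using assms(3) by (simp add: d_def)
  have v: "v \<noteq> 0" unfolding v_def by (rule euler_dir_nonzero)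
  have \<alpha>: "\<alpha> > 0" unfolding \<alpha>_def by (rule feuerbach_shift_pos)
  have \<alpha>d: "d * \<alpha> = 2 * a\<^sup>2 * b\<^sup>2" using feuerbach_shift_eq by (simp add: d_def \<alpha>_def)
  have C: "C = ept a b w"
    unfolding assms(4-6) cd by (simp add: w_def ept_def locus_center_def d_def)
  have v': "v = (Re w / a, - (Im w / b))" by (simp add: v_def euler_dir_def w_def)
  have \<alpha>v: "\<alpha> *\<^sub>R v = (2 * b\<^sup>2 / d * (a * Re w), - (2 * a\<^sup>2 / d * (b * Im w)))"
  proof -
    have \<alpha>': "\<alpha> = 2 * a\<^sup>2 * b\<^sup>2 / d" using \<alpha>d d by (simp add: field_simps)
    show ?thesis unfolding v' \<alpha>' using a ab d by (simp add: power2_eq_square)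
  qed
  have ceq: "C = (a * Re w, b * Im w)" by (simp add: C ept_def)
  have X11: "X11 = C + \<alpha> *\<^sub>R v"
  proof -
    have "X11 = ((a\<^sup>2 + b\<^sup>2) / d * (a * Re w), - ((a\<^sup>2 + b\<^sup>2) / d * (b * Im w)))"
      using ceq assms(6) unfolding assms(9) cd by simp
    \<comment> \<open>Two forms of one coefficient: \<open>\<alpha> *\<^sub>R v\<close> adds 2 b^2 /
      d times the first coordinate of C and subtracts 2 a^2 / d times the second, which reverses the
      sign of the latter.\<close>
    moreover have "(a\<^sup>2 + b\<^sup>2) / d = 1 + 2 * b\<^sup>2 / d" "(a\<^sup>2 + b\<^sup>2) / d = 2 * a\<^sup>2 / d - 1"
      using d by (simp_all add: field_simps) (simp_all add: d_def)
    ultimately show ?thesis unfolding \<alpha>v ceq by (simp add: algebra_simps)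
  qed
  have X80: "X80 = C + (2 * \<alpha>) *\<^sub>R v"
  proof -
    have cs: "cos t = (a\<^sup>2 + 3 * b\<^sup>2) / d * Re w" "sin t = (3 * a\<^sup>2 + b\<^sup>2) / d * Im w"
      using locus_center_parts[of t] d by (simp_all add: w_def d_def)
    have co: "(a\<^sup>2 + 3 * b\<^sup>2) / d = 1 + 4 * b\<^sup>2 / d" "(3 * a\<^sup>2 + b\<^sup>2) / d = 4 * a\<^sup>2 / d - 1"
      using d by (simp_all add: field_simps) (simp_all add: d_def)
    have "C + (2 * \<alpha>) *\<^sub>R v = C + 2 *\<^sub>R (\<alpha> *\<^sub>R v)" by simp
    thus ?thesis unfolding \<alpha>v ceq assms(10) cs co by (simp add: algebra_simps)
  qed
  have fam: "\<exists>x y z. T = (ept a b x, ept a b y, ept a b z) \<and>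
      blaschke_triple (caustic_focus a b w (locus_inradius a b t)) (caustic_focus a b w (- locus_inradius a b t)) x y z" if "T \<in> \<T>" for T
    using that unfolding assms(7) C w_def by (cases T) (use family_iff in blast)
  have L5: "\<L>\<^sub>5 = closed_segment C (C - (d / 2) *\<^sub>R v)"
    unfolding assms(7,8) C w_def v_def d_def by (rule euler_locus_family)
  have ext: "extension_beyond \<L>\<^sub>5 C = {C + \<tau> *\<^sub>R v | \<tau>. 0 \<le> \<tau>}"
    unfolding L5 by (rule extension_beyond_segment) (use d v in simp_all)
  have r: "locus_inradius a b t = \<alpha> * norm v" by (simp add: locus_inradius_def \<alpha>_def v_def)
  have C_int: "C \<in> ellipse_interior a b"
  proof -
    have "0 < b\<^sup>2 * (1 - (cmod w)\<^sup>2)"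
      using sphere_inside_ellipse(3)[OF locus_inradius_pos locus_incircle_inside, of t]
      by (simp add: w_def) (meson le_less_trans zero_le_power2)
    hence "(cmod w)\<^sup>2 < 1" using ab by (simp add: zero_less_mult_iff)
    thus ?thesis unfolding C ept_in_interior_iff[OF a ab(1)] .
  qed
  have X80_on: "X80 \<in> ellipse a b"
    using a ab by (simp add: assms(10) ellipse_def power_mult_distrib)
  have 1: "\<exists>D. D \<noteq> C \<and> \<L>\<^sub>5 = closed_segment C D"
    using L5 d v by (intro exI[of _ "C - (d / 2) *\<^sub>R v"]) simp
  have 2: "\<forall>T\<in>\<T>. \<forall>p. is_feuerbach_point T p \<longleftrightarrow> \<not> equilateral T \<and> p = X11"
    using fam feuerbach_iff unfolding X11 C w_def \<alpha>_def v_def by metis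
  have 3: "\<forall>T\<in>\<T>. \<forall>p. is_X80 T p \<longleftrightarrow> \<not> equilateral T \<and> p = X80"
    using fam X80_iff unfolding X80 C w_def \<alpha>_def v_def by metis
  have 4: "\<forall>T\<in>\<T>. is_incircle T C (locus_inradius a b t)"
    using fam blaschke_is_incircle[OF locus_inradius_pos locus_incircle_inside _ porism_locus]
    unfolding C w_def by metis
  have 5: "extension_beyond \<L>\<^sub>5 C \<inter> sphere C (locus_inradius a b t) - {C} = {X11}"
  proof (intro equalityI subsetI)
    fix p assume "p \<in> extension_beyond \<L>\<^sub>5 C \<inter> sphere C (locus_inradius a b t) - {C}"
    then obtain \<tau> where \<tau>: "0 \<le> \<tau>" "p = C + \<tau> *\<^sub>R v" "dist C p = \<alpha> * norm v"
      unfolding ext r by auto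
    hence "\<tau> * norm v = \<alpha> * norm v" by (simp add: dist_norm)
    hence "\<tau> = \<alpha>" using v by simp
    thus "p \<in> {X11}" using \<tau> X11 by simp
  next
    fix p assume "p \<in> {X11}"
    thus "p \<in> extension_beyond \<L>\<^sub>5 C \<inter> sphere C (locus_inradius a b t) - {C}"
      unfolding ext r X11 using \<alpha> v less_imp_le by (auto simp: dist_norm)
  qed
  have 6: "extension_beyond \<L>\<^sub>5 C \<inter> ellipse a b - {C} = {X80}"
  proof (intro equalityI subsetI)
    fix p assume "p \<in> extension_beyond \<L>\<^sub>5 C \<inter> ellipse a b - {C}"
    then obtain \<tau> where \<tau>: "0 \<le> \<tau>" "p = C + \<tau> *\<^sub>R v" "p \<in> ellipse a b"
      unfolding ext by auto
    have "\<tau> = 2 * \<alpha>"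
      by (rule ray_meets_ellipse_once[OF a ab(1) C_int \<tau>(1)]) (use \<tau> \<alpha> X80 X80_on in auto)
    thus "p \<in> {X80}" using \<tau> X80 by simp
  next
    fix p assume "p \<in> {X80}"
    hence p: "p = C + (2 * \<alpha>) *\<^sub>R v" "p \<in> ellipse a b" using X80 X80_on by simp_all
    moreover have "0 \<le> 2 * \<alpha>" using \<alpha> by simp
    moreover have "p \<noteq> C" using p(1) \<alpha> v by simp
    ultimately show "p \<in> extension_beyond \<L>\<^sub>5 C \<inter> ellipse a b - {C}"
      unfolding ext by blast
  qed
  show ?thesis using 1 2 3 4 5 6 locus_inradius_pos by blast
qed

end
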